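(* Let $A$ be an $H^*$-Galois left $H$-module algebra over a finite dimensional Hopf algebra $H$ and let $E=\operatorname{End}_HA$ with its Hopf algebra structure. If $V\subset A$ is an $H$-invariant subspace which generates the algebra $A$ and $\iota:V\to A$ is the inclusion map, then the algebra $E^*$ is generated by the elements $\Upsilon_{\tau\iota}$ with $\tau\in D({}^*V)$.
   Context: $k$ is a field; unadorned $\otimes$, $\operatorname{Hom}$, $\operatorname{End}$ are over $k$. $H$ is a finite dimensional Hopf algebra over $k$ with $\Delta h=\sum_{(h)}h'\otimes h''$, counit $\varepsilon$, antipode $S$. Algebras are extensions of $k$ (so $A\neq0$, $k=k1_A\subset A$). A left $H$-module algebra $A$ is $H^*$-Galois if the map $\pi:A\otimes H\to\operatorname{End}A$, $\pi(a\otimes h)(b)=a(hb)$, is bijective; equivalently (known fact) if any one of the maps $\pi'(a\otimes h)(b)=(hb)a$ from $A\otimes H$ to $\operatorname{End}A$, $\gamma(a\otimes b)(h)=a(hb)$, $\gamma'(a\otimes b)(h)=(ha)b$ from $A\otimes A$ to $\operatorname{Hom}(H,A)\cong A\otimes H^*$ is bijective. Then $\dim A<\infty$ and $A^H=\{a:ha=\varepsilon(h)a\ \forall h\in H\}=k$. $E=\operatorname{End}_HA$ acts on $A$ from the left and carries the unique Hopf algebra structure making $A$ a left $E$-module algebra: $\varphi(ab)=\sum_{(\varphi)}\varphi'(a)\varphi''(b)$, $\varepsilon(\varphi)=\varphi(1)$; $E^*$ is the dual Hopf algebra. For a finite dimensional left $H$-module $V$, the right dual ${}^*V$ is the dual vector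 space with $H$-action $\langle h\xi,v\rangle=\langle\xi,S^{-1}(h)v\rangle$, and $D(W)=\operatorname{Hom}_H(W,A)$. For $\sigma\in D(V)$, $\tau\in D({}^*V)$ and dual bases $\{e_i\}$, $\{e_i^*\}$ of $V$ and its dual space, $\Upsilon_{\tau\sigma}\in E^*$ is defined by $\langle\Upsilon_{\tau\sigma},\varphi\rangle=\sum_i\tau(e_i^* )\cdot\varphi(\sigma(e_i))$ for $\varphi\in E$ (the right hand side lies in $A^H=k$). *)

theory Defs
  imports Complex_Main "HOL-Library.Function_Algebras"
begin

section \<open>Tensor products\<close>

text \<open>
  A list \<open>[(v\<^sub>1, w\<^sub>1), \<dots>, (v\<^sub>n, w\<^sub>n)]\<close> stands for the tensor
  \<open>v\<^sub>1 \<otimes> w\<^sub>1 + \<dots> + v\<^sub>n \<otimes> w\<^sub>n\<close>. Two lists represent the same tensor iff they are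
  related by the congruence on formal sums generated by the defining relations of the
  tensor product. (Modulo these relations formal sums already form a group:
  \<open>(- v, w)\<close> is the negative of \<open>(v, w)\<close>.)
\<close>

inductive formal_sum_eq :: "('g list \<Rightarrow> 'g list \<Rightarrow> bool) \<Rightarrow> 'g list \<Rightarrow> 'g list \<Rightarrow> bool"
  for R where
  base: "R xs ys \<Longrightarrow> formal_sum_eq R xs ys"
| refl: "formal_sum_eq R xs xs"
| sym: "formal_sum_eq R xs ys \<Longrightarrow> formal_sum_eq R ys xs"
| trans: "formal_sum_eq R xs ys \<Longrightarrow> formal_sum_eq R ys zs \<Longrightarrow> formal_sum_eq R xs zs"
| plus: "formal_sum_eq R xs xs' \<Longrightarrow> formal_sum_eq R ys ys' \<Longrightarrow> formal_sum_eq R (xs @ ys) (xs' @ ys')"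
| commute: "formal_sum_eq R (xs @ ys) (ys @ xs)"

inductive tensor_rel ::
  "('k \<Rightarrow> 'v \<Rightarrow> 'v) \<Rightarrow> ('k \<Rightarrow> 'w \<Rightarrow> 'w) \<Rightarrow>
    ('v::ab_group_add \<times> 'w::ab_group_add) list \<Rightarrow> ('v \<times> 'w) list \<Rightarrow> bool"
  for sV :: "'k \<Rightarrow> 'v \<Rightarrow> 'v" and sW :: "'k \<Rightarrow> 'w \<Rightarrow> 'w" where
  add_left: "tensor_rel sV sW [(v + v', w)] [(v, w), (v', w)]"
| add_right: "tensor_rel sV sW [(v, w + w')] [(v, w), (v, w')]"
| scale: "tensor_rel sV sW [(sV c v, w)] [(v, sW c w)]"
| zero_left: "tensor_rel sV sW [(0, w)] []"
| zero_right: "tensor_rel sV sW [(v, 0)] []"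

definition tensor_eq ::
  "('k \<Rightarrow> 'v \<Rightarrow> 'v) \<Rightarrow> ('k \<Rightarrow> 'w \<Rightarrow> 'w) \<Rightarrow>
    ('v::ab_group_add \<times> 'w::ab_group_add) list \<Rightarrow> ('v \<times> 'w) list \<Rightarrow> bool" where
  "tensor_eq sV sW = formal_sum_eq (tensor_rel sV sW)"

definition tensor_product ::
  "('k \<Rightarrow> 'v \<Rightarrow> 'v) \<Rightarrow> ('k \<Rightarrow> 'w \<Rightarrow> 'w) \<Rightarrow>
    ('v::ab_group_add \<times> 'w::ab_group_add) list set set" where
  "tensor_product sV sW = UNIV // {(xs, ys). tensor_eq sV sW xs ys}"

inductive tensor3_rel ::
  "('k \<Rightarrow> 'v \<Rightarrow> 'v) \<Rightarrow>
    ('v::ab_group_add \<times> 'v \<times> 'v) list \<Rightarrow> ('v \<times> 'v \<times> 'v) list \<Rightarrow> bool"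
  for s :: "'k \<Rightarrow> 'v \<Rightarrow> 'v" where
  add1: "tensor3_rel s [(u + u', v, w)] [(u, v, w), (u', v, w)]"
| add2: "tensor3_rel s [(u, v + v', w)] [(u, v, w), (u, v', w)]"
| add3: "tensor3_rel s [(u, v, w + w')] [(u, v, w), (u, v, w')]"
| scale12: "tensor3_rel s [(s c u, v, w)] [(u, s c v, w)]"
| scale23: "tensor3_rel s [(u, s c v, w)] [(u, v, s c w)]"
| zero1: "tensor3_rel s [(0, v, w)] []"
| zero2: "tensor3_rel s [(u, 0, w)] []"
| zero3: "tensor3_rel s [(u, v, 0)] []"

definition tensor3_eq ::
  "('k \<Rightarrow> 'v \<Rightarrow> 'v) \<Rightarrow>
    ('v::ab_group_add \<times> 'v \<times> 'v) list \<Rightarrow> ('v \<times> 'v \<times> 'v) list \<Rightarrow> bool" where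
  "tensor3_eq s = formal_sum_eq (tensor3_rel s)"

section \<open>Algebras, Hopf algebras and module algebras\<close>

definition finite_dim :: "('k::field \<Rightarrow> 'v::ab_group_add \<Rightarrow> 'v) \<Rightarrow> bool" where
  "finite_dim s \<longleftrightarrow> (\<exists>B. finite B \<and> module.span s B = UNIV)"

text \<open>The class \<open>ring_1\<close> includes \<open>0 \<noteq> 1\<close>, so algebras are nonzero.\<close>

locale k_algebra = vector_space scale
  for scale :: "'k::field \<Rightarrow> 'a::ring_1 \<Rightarrow> 'a" +
  assumes scale_mult_left: "scale c x * y = scale c (x * y)"
    and scale_mult_right: "x * scale c y = scale c (x * y)"

text \<open>
  \<open>comult h\<close> is a list of pairs representing \<open>\<Delta> h = \<Sum> h' \<otimes> h''\<close>. All conditions on \<open>comult\<close>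
  are conditions on the tensors represented.
\<close>

locale hopf_algebra = k_algebra scale
  for scale :: "'k::field \<Rightarrow> 'h::ring_1 \<Rightarrow> 'h" +
  fixes comult :: "'h \<Rightarrow> ('h \<times> 'h) list"
    and counit :: "'h \<Rightarrow> 'k"
    and antipode :: "'h \<Rightarrow> 'h"
  assumes comult_add:
      "tensor_eq scale scale (comult (g + h)) (comult g @ comult h)"
    and comult_scale:
      "tensor_eq scale scale (comult (scale c h)) [(scale c u, v). (u, v) \<leftarrow> comult h]"
    and coassoc:
      "tensor3_eq scale
        [(u\<^sub>1, u\<^sub>2, v). (u, v) \<leftarrow> comult h, (u\<^sub>1, u\<^sub>2) \<leftarrow> comult u]
        [(u, v\<^sub>1, v\<^sub>2). (u, v) \<leftarrow> comult h, (v\<^sub>1, v\<^sub>2) \<leftarrow> comult v]"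
    and linear_counit: "Vector_Spaces.linear scale (*) counit"
    and counit_left: "(\<Sum>(u, v)\<leftarrow>comult h. scale (counit u) v) = h"
    and counit_right: "(\<Sum>(u, v)\<leftarrow>comult h. scale (counit v) u) = h"
    and comult_mult:
      "tensor_eq scale scale (comult (g * h))
        [(u * u', v * v'). (u, v) \<leftarrow> comult g, (u', v') \<leftarrow> comult h]"
    and comult_one: "tensor_eq scale scale (comult 1) [(1, 1)]"
    and counit_mult: "counit (g * h) = counit g * counit h"
    and counit_one: "counit 1 = 1"
    and linear_antipode: "Vector_Spaces.linear scale scale antipode"
    and antipode_left: "(\<Sum>(u, v)\<leftarrow>comult h. antipode u * v) = scale (counit h) 1"
    and antipode_right: "(\<Sum>(u, v)\<leftarrow>comult h. u * antipode v) = scale (counit h) 1"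

locale module_algebra =
  H: hopf_algebra sH comult counit antipode + A: k_algebra sA
  for sH :: "'k::field \<Rightarrow> 'h::ring_1 \<Rightarrow> 'h" and comult counit antipode
    and sA :: "'k \<Rightarrow> 'a::ring_1 \<Rightarrow> 'a" +
  fixes act :: "'h \<Rightarrow> 'a \<Rightarrow> 'a"
  assumes linear_act_left: "Vector_Spaces.linear sH sA (\<lambda>h. act h a)"
    and linear_act_right: "Vector_Spaces.linear sA sA (act h)"
    and act_one: "act 1 a = a"
    and act_act: "act (g * h) a = act g (act h a)"
    and act_mult: "act h (a * b) = (\<Sum>(u, v)\<leftarrow>comult h. act u a * act v b)"
    and act_unit: "act h 1 = sA (counit h) 1"

text \<open>
  \<open>galois_map\<close> is evaluated on representatives of tensors; the map \<open>\<pi>\<close> it induces on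
  \<open>A \<otimes> H\<close> sends a class \<open>T\<close> to the common value on the elements of \<open>T\<close>.
\<close>

definition galois_map :: "('h \<Rightarrow> 'a \<Rightarrow> 'a) \<Rightarrow> ('a \<times> 'h) list \<Rightarrow> 'a \<Rightarrow> 'a::ring_1" where
  "galois_map act xs b = (\<Sum>(a, h)\<leftarrow>xs. a * act h b)"

definition galois ::
  "('k::field \<Rightarrow> 'h::ring_1 \<Rightarrow> 'h) \<Rightarrow> ('k \<Rightarrow> 'a::ring_1 \<Rightarrow> 'a) \<Rightarrow> ('h \<Rightarrow> 'a \<Rightarrow> 'a) \<Rightarrow> bool" where
  "galois sH sA act \<longleftrightarrow>
    bij_betw (\<lambda>T. the_elem (galois_map act ` T)) (tensor_product sA sH)
      {f. Vector_Spaces.linear sA sA f}"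

section \<open>Linear maps on subspaces, and subalgebras\<close>

text \<open>
  Linear maps whose domain is a subspace \<open>C\<close> of a type are extended by \<open>0\<close> outside \<open>C\<close>, so that
  they are determined by their values on \<open>C\<close> and form a subspace under pointwise operations.
\<close>

definition lin_maps ::
  "('k \<Rightarrow> 'v \<Rightarrow> 'v) \<Rightarrow> 'v set \<Rightarrow> ('k \<Rightarrow> 'w \<Rightarrow> 'w) \<Rightarrow> ('v::ab_group_add \<Rightarrow> 'w::ab_group_add) set" where
  "lin_maps sV C sW = {f. (\<forall>x\<in>C. \<forall>y\<in>C. f (x + y) = f x + f y) \<and>
     (\<forall>c. \<forall>x\<in>C. f (sV c x) = sW c (f x)) \<and> (\<forall>x. x \<notin> C \<longrightarrow> f x = 0)}"

definition fun_scale :: "('k \<Rightarrow> 'w \<Rightarrow> 'w) \<Rightarrow> 'k \<Rightarrow> ('v \<Rightarrow> 'w) \<Rightarrow> 'v \<Rightarrow> 'w" where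
  "fun_scale s c f = (\<lambda>x. s c (f x))"

definition dual_space :: "('k::field \<Rightarrow> 'v \<Rightarrow> 'v) \<Rightarrow> 'v set \<Rightarrow> ('v::ab_group_add \<Rightarrow> 'k) set" where
  "dual_space s C = lin_maps s C (*)"

definition subalgebra ::
  "('k::field \<Rightarrow> 'b::ab_group_add \<Rightarrow> 'b) \<Rightarrow> ('b \<Rightarrow> 'b \<Rightarrow> 'b) \<Rightarrow> 'b \<Rightarrow> 'b set \<Rightarrow> 'b set \<Rightarrow> bool" where
  "subalgebra s mult unit C B \<longleftrightarrow> B \<subseteq> C \<and> module.subspace s B \<and> unit \<in> B \<and>
     (\<forall>x\<in>B. \<forall>y\<in>B. mult x y \<in> B)"

text \<open>The subset \<open>X\<close> of the algebra with carrier \<open>C\<close> generates it as a unital algebra.\<close>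

definition generates ::
  "('k::field \<Rightarrow> 'b::ab_group_add \<Rightarrow> 'b) \<Rightarrow> ('b \<Rightarrow> 'b \<Rightarrow> 'b) \<Rightarrow> 'b \<Rightarrow> 'b set \<Rightarrow> 'b set \<Rightarrow> bool" where
  "generates s mult unit C X \<longleftrightarrow> X \<subseteq> C \<and> subalgebra s mult unit C hull X = C"

section \<open>The algebra dual to \<open>End\<^sub>H A\<close>\<close>

definition H_hom ::
  "('k \<Rightarrow> 'v \<Rightarrow> 'v) \<Rightarrow> 'v set \<Rightarrow> ('h \<Rightarrow> 'v \<Rightarrow> 'v) \<Rightarrow>
    ('k \<Rightarrow> 'w \<Rightarrow> 'w) \<Rightarrow> ('h \<Rightarrow> 'w \<Rightarrow> 'w) \<Rightarrow> ('v::ab_group_add \<Rightarrow> 'w::ab_group_add) set" where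
  "H_hom sV V actV sW actW =
    {f \<in> lin_maps sV V sW. \<forall>h. \<forall>v\<in>V. f (actV h v) = actW h (f v)}"

definition End_H ::
  "('k::field \<Rightarrow> 'a::ring_1 \<Rightarrow> 'a) \<Rightarrow> ('h \<Rightarrow> 'a \<Rightarrow> 'a) \<Rightarrow> ('a \<Rightarrow> 'a) set" where
  "End_H sA act = H_hom sA UNIV act sA act"

text \<open>
  The comultiplication and the counit of \<open>E = End\<^sub>H A\<close> are determined by
  \<open>\<phi>(ab) = \<Sum> \<phi>'(a) \<phi>''(b)\<close> and \<open>\<epsilon>(\<phi>) = \<phi>(1)\<close>; the algebra structure of the dual \<open>E\<^sup>*\<close> depends
  on nothing else. As for \<open>H\<close>, \<open>\<Delta> \<phi> \<in> E \<otimes> E\<close> is given by a representing list of pairs.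
\<close>

definition E_comult ::
  "('k::field \<Rightarrow> 'a::ring_1 \<Rightarrow> 'a) \<Rightarrow> ('h \<Rightarrow> 'a \<Rightarrow> 'a) \<Rightarrow> ('a \<Rightarrow> 'a) \<Rightarrow> (('a \<Rightarrow> 'a) \<times> ('a \<Rightarrow> 'a)) list" where
  "E_comult sA act \<phi> = (SOME xs. set xs \<subseteq> End_H sA act \<times> End_H sA act \<and>
     (\<forall>a b. \<phi> (a * b) = (\<Sum>(\<phi>', \<phi>'')\<leftarrow>xs. \<phi>' a * \<phi>'' b)))"

definition scalar_of :: "('k::field \<Rightarrow> 'a::ring_1 \<Rightarrow> 'a) \<Rightarrow> 'a \<Rightarrow> 'k" where
  "scalar_of sA a = (THE c. a = sA c 1)"

definition E_counit ::
  "('k::field \<Rightarrow> 'a::ring_1 \<Rightarrow> 'a) \<Rightarrow> ('h \<Rightarrow> 'a \<Rightarrow> 'a) \<Rightarrow> ('a \<Rightarrow> 'a) \<Rightarrow> 'k" where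
  "E_counit sA act \<phi> = (if \<phi> \<in> End_H sA act then scalar_of sA (\<phi> 1) else 0)"

definition E_dual ::
  "('k::field \<Rightarrow> 'a::ring_1 \<Rightarrow> 'a) \<Rightarrow> ('h \<Rightarrow> 'a \<Rightarrow> 'a) \<Rightarrow> (('a \<Rightarrow> 'a) \<Rightarrow> 'k) set" where
  "E_dual sA act = dual_space (fun_scale sA) (End_H sA act)"

definition E_dual_mult ::
  "('k::field \<Rightarrow> 'a::ring_1 \<Rightarrow> 'a) \<Rightarrow> ('h \<Rightarrow> 'a \<Rightarrow> 'a) \<Rightarrow>
    (('a \<Rightarrow> 'a) \<Rightarrow> 'k) \<Rightarrow> (('a \<Rightarrow> 'a) \<Rightarrow> 'k) \<Rightarrow> ('a \<Rightarrow> 'a) \<Rightarrow> 'k" where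
  "E_dual_mult sA act f g \<phi> =
    (if \<phi> \<in> End_H sA act then \<Sum>(\<phi>', \<phi>'')\<leftarrow>E_comult sA act \<phi>. f \<phi>' * g \<phi>'' else 0)"

section \<open>The elements \<open>\<Upsilon>\<^sub>\<tau>\<^sub>\<sigma>\<close>\<close>

text \<open>
  The action on the right dual: \<open>\<langle>h \<xi>, v\<rangle> = \<langle>\<xi>, S\<^sup>-\<^sup>1(h) v\<rangle>\<close> for \<open>v \<in> V\<close>. The antipode of a
  finite dimensional Hopf algebra is bijective.
\<close>

definition rdual_act ::
  "('h \<Rightarrow> 'h) \<Rightarrow> 'v set \<Rightarrow> ('h \<Rightarrow> 'v \<Rightarrow> 'v) \<Rightarrow> 'h \<Rightarrow> ('v \<Rightarrow> 'k) \<Rightarrow> ('v::ab_group_add \<Rightarrow> 'k::field)" where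
  "rdual_act antipode V actV h \<xi> = (\<lambda>v. if v \<in> V then \<xi> (actV (inv antipode h) v) else 0)"

definition D_rdual ::
  "('h \<Rightarrow> 'h) \<Rightarrow> ('k::field \<Rightarrow> 'v::ab_group_add \<Rightarrow> 'v) \<Rightarrow> 'v set \<Rightarrow> ('h \<Rightarrow> 'v \<Rightarrow> 'v) \<Rightarrow>
    ('k \<Rightarrow> 'a::ring_1 \<Rightarrow> 'a) \<Rightarrow> ('h \<Rightarrow> 'a \<Rightarrow> 'a) \<Rightarrow> (('v \<Rightarrow> 'k) \<Rightarrow> 'a) set" where
  "D_rdual antipode sV V actV sA act =
    H_hom (fun_scale (*)) (dual_space sV V) (rdual_act antipode V actV) sA act"

definition some_basis :: "('k::field \<Rightarrow> 'v::ab_group_add \<Rightarrow> 'v) \<Rightarrow> 'v set \<Rightarrow> 'v set" where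
  "some_basis s V = (SOME B. \<not> module.dependent s B \<and> module.span s B = V)"

definition dual_vector ::
  "('k::field \<Rightarrow> 'v::ab_group_add \<Rightarrow> 'v) \<Rightarrow> 'v set \<Rightarrow> 'v \<Rightarrow> 'v \<Rightarrow> 'k" where
  "dual_vector s V e =
    (\<lambda>v. if v \<in> V then module.representation s (some_basis s V) v e else 0)"

definition Upsilon ::
  "('k::field \<Rightarrow> 'v::ab_group_add \<Rightarrow> 'v) \<Rightarrow> 'v set \<Rightarrow> ('k \<Rightarrow> 'a::ring_1 \<Rightarrow> 'a) \<Rightarrow> ('h \<Rightarrow> 'a \<Rightarrow> 'a) \<Rightarrow>
    (('v \<Rightarrow> 'k) \<Rightarrow> 'a) \<Rightarrow> ('v \<Rightarrow> 'a) \<Rightarrow> ('a \<Rightarrow> 'a) \<Rightarrow> 'k" where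
  "Upsilon sV V sA act \<tau> \<sigma> \<phi> =
    (if \<phi> \<in> End_H sA act
     then scalar_of sA (\<Sum>e\<in>some_basis sV V. \<tau> (dual_vector sV V e) * \<phi> (\<sigma> e))
     else 0)"

definition inclusion :: "'a set \<Rightarrow> 'a \<Rightarrow> 'a::ab_group_add" where
  "inclusion V = (\<lambda>v. if v \<in> V then v else 0)"

end

theory Submission
  imports Defs
begin

text \<open>
  Everything rests on one family of tensors. Since \<open>A \<otimes> H \<rightarrow> End A\<close> is bijective and \<open>A\<close> is finite
  dimensional, each coordinate function \<open>e\<^sup>*\<close> of a basis of \<open>A\<close>, regarded as the endomorphism
  \<open>b \<mapsto> e\<^sup>*(b) 1\<close>, is the image of a unique tensor \<open>\<Sum> y \<otimes> g\<close> (\<open>coord_tensor e\<close>). Injectivity turns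
  identities of endomorphisms into identities in \<open>A \<otimes> H\<close>, which can then be applied outside \<open>End A\<close>:
  summing over the basis, \<open>\<Sum>\<^sub>e (h e) y \<otimes> g = 1 \<otimes> h\<close> (\<open>sum_coord_tensor\<close>), and, because the image of
  \<open>e\<^sup>*\<close> consists of invariants, \<open>S(k) y \<otimes> g = y \<otimes> k g\<close> (\<open>coord_tensor_antipode\<close>). So whenever \<open>g\<close> is
  made to act on something, the coefficient \<open>y\<close> produces an \<open>H\<close>-linear map; and summing these maps
  over the basis recovers what one started from.

  Used on \<open>V\<close>, this gives for \<open>v \<in> V\<close> maps \<open>\<tau>\<^sub>e(\<xi>) = \<Sum> \<xi>(g v) y\<close> in \<open>D(\<^sup>*V)\<close> with \<open>\<Sum>\<^sub>e e \<tau>\<^sub>e(\<xi>) = \<xi>(v) 1\<close>.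
  Hence an endomorphism \<open>\<phi> \<in> E\<close> on which all \<open>\<Upsilon>\<^sub>\<tau>\<^sub>\<iota>\<close> vanish is zero on \<open>V\<close> (\<open>Upsilon_nondegenerate\<close>).
  Now let \<open>B\<close> be a subalgebra of \<open>E\<^sup>*\<close> containing all \<open>\<Upsilon>\<^sub>\<tau>\<^sub>\<iota>\<close>, let \<open>N \<subseteq> E\<close> be its annihilator and
  \<open>W\<close> the set of all \<open>a \<in> A\<close> with \<open>N a = 0\<close>. Then \<open>V \<subseteq> W\<close>, and \<open>W\<close> is a subalgebra of \<open>A\<close>: for
  \<open>a \<in> W\<close> the matrix coefficients \<open>\<phi> \<mapsto> e\<^sup>*(\<phi> a)\<close> vanish on \<open>N\<close>, so they belong to \<open>B\<close> by duality,
  hence so do the products of two of them, whose values at \<open>\<phi>\<close> determine \<open>\<phi>(a b)\<close>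
  (\<open>subalgebra_common_kernel\<close>). As \<open>V\<close> generates \<open>A\<close>, \<open>W = A\<close> and \<open>N = 0\<close>; by duality \<open>B = E\<^sup>*\<close>.

  Several standard facts are established on the way. \<open>A\<close> is finite dimensional, because an infinite
  dimensional space has too many endomorphisms for \<open>A \<otimes> H\<close> (\<open>finite_dim_A\<close>). The antipode is
  bijective, because every functional on \<open>H\<close> factors through it
  (\<open>functional_factors_through_antipode\<close>). The multiplication of \<open>E\<^sup>*\<close> makes sense, because a basis
  of \<open>E\<close> is a basis of the left \<open>A\<close>-module \<open>End A\<close> (\<open>sum_E_coeff\<close>, \<open>E_basis_free\<close>): this yields
  the existence of \<open>\<Delta>\<close> on \<open>E\<close>, by comparing coefficients in \<open>b \<mapsto> \<phi>(a b)\<close>, and its uniqueness.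
\<close>

section \<open>Evaluating tensors\<close>

text \<open>
  The value at a tensor of the linear map induced by a balanced biadditive map. Tensor
  identities are stated and applied below through such values.
\<close>

definition tsum :: "('v \<times> 'w) list \<Rightarrow> ('v \<Rightarrow> 'w \<Rightarrow> 'x::comm_monoid_add) \<Rightarrow> 'x" where
  "tsum xs B = (\<Sum>(u, v)\<leftarrow>xs. B u v)"

lemma tsum_Nil [simp]: "tsum [] B = 0"
  and tsum_Cons [simp]: "tsum (p # xs) B = B (fst p) (snd p) + tsum xs B"
  and tsum_append [simp]: "tsum (xs @ ys) B = tsum xs B + tsum ys B"
  by (simp_all add: tsum_def case_prod_beta)

lemma tsum_zero [simp]: "tsum xs (\<lambda>u v. 0) = 0"
  by (induction xs) auto

lemma tsum_cong: "(\<And>u v. (u, v) \<in> set xs \<Longrightarrow> B u v = B' u v) \<Longrightarrow> tsum xs B = tsum xs B'"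
  by (induction xs) auto

lemma tsum_add: "tsum xs (\<lambda>u v. B u v + B' u v) = tsum xs B + tsum xs B'"
  by (induction xs) (auto simp: add_ac)

lemma tsum_sum: "tsum xs (\<lambda>u v. \<Sum>i\<in>I. B i u v) = (\<Sum>i\<in>I. tsum xs (B i))"
  by (induction xs) (auto simp: sum.distrib)

lemma tsum_swap: "tsum xs (\<lambda>u v. tsum ys (B u v)) = tsum ys (\<lambda>w z. tsum xs (\<lambda>u v. B u v w z))"
  by (induction xs) (auto simp: tsum_add)

lemma tsum_hom:
  fixes f :: "'x::ab_group_add \<Rightarrow> 'y::ab_group_add"
  assumes "\<And>x y. f (x + y) = f x + f y"
  shows "f (tsum xs B) = tsum xs (\<lambda>u v. f (B u v))"
proof -
  have "f 0 = 0" using assms[of 0 0] by simp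
  then show ?thesis by (induction xs) (auto simp: assms)
qed

lemma tsum_mult_left: "c * tsum xs B = tsum xs (\<lambda>u v. (c::'x::ring) * B u v)"
  and tsum_mult_right: "tsum xs B * c = tsum xs (\<lambda>u v. B u v * (c::'x::ring))"
  by (induction xs; simp add: algebra_simps)+

lemma tsum_map [simp]: "tsum (map (\<lambda>(u, v). (f u v, g u v)) xs) B = tsum xs (\<lambda>u v. B (f u v) (g u v))"
  by (induction xs) auto

lemma tsum_concat: "tsum (concat (map F L)) B = (\<Sum>x\<leftarrow>L. tsum (F x) B)"
  by (induction L) auto

lemma tsum_concat_pairs: "tsum (concat (map (\<lambda>(u, v). F u v) L)) B = tsum L (\<lambda>u v. tsum (F u v) B)"
  by (induction L) auto

definition tsum3 :: "('u \<times> 'v \<times> 'w) list \<Rightarrow> ('u \<Rightarrow> 'v \<Rightarrow> 'w \<Rightarrow> 'x::comm_monoid_add) \<Rightarrow> 'x" where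
  "tsum3 xs T = (\<Sum>(u, v, w)\<leftarrow>xs. T u v w)"

text \<open>
  Scalars only have to move across the tensor sign, so the target is a mere abelian group.
\<close>

definition balanced ::
  "('k \<Rightarrow> 'v \<Rightarrow> 'v) \<Rightarrow> ('k \<Rightarrow> 'w \<Rightarrow> 'w) \<Rightarrow>
    ('v::ab_group_add \<Rightarrow> 'w::ab_group_add \<Rightarrow> 'x::ab_group_add) \<Rightarrow> bool" where
  "balanced sV sW B \<longleftrightarrow>
    (\<forall>v v' w. B (v + v') w = B v w + B v' w) \<and> (\<forall>v w w'. B v (w + w') = B v w + B v w') \<and>
    (\<forall>c v w. B (sV c v) w = B v (sW c w))"

definition balanced3 ::
  "('k \<Rightarrow> 'v \<Rightarrow> 'v) \<Rightarrow>
    ('v::ab_group_add \<Rightarrow> 'v \<Rightarrow> 'v \<Rightarrow> 'x::ab_group_add) \<Rightarrow> bool" where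
  "balanced3 s T \<longleftrightarrow> (\<forall>w. balanced s s (\<lambda>u v. T u v w)) \<and> (\<forall>u. balanced s s (T u))"

lemma formal_sum_eq_sum_list:
  fixes f :: "'g \<Rightarrow> 'x::ab_group_add"
  assumes "formal_sum_eq R xs ys" "\<And>xs ys. R xs ys \<Longrightarrow> sum_list (map f xs) = sum_list (map f ys)"
  shows "sum_list (map f xs) = sum_list (map f ys)"
  using assms by (induction rule: formal_sum_eq.induct) (auto simp: add.commute)

lemma additive_zero: "(\<And>x y. f (x + y) = f x + f y) \<Longrightarrow> f (0::'a::ab_group_add) = (0::'b::ab_group_add)"
  by (metis add_cancel_right_right)

lemma balanced_zero:
  assumes "balanced sV sW B"
  shows "B 0 w = 0" "B v 0 = 0"
  using assms additive_zero[of "\<lambda>v. B v w"] additive_zero[of "B v"]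
  by (simp_all add: balanced_def)

lemma tensor_eq_tsum:
  assumes "tensor_eq sV sW xs ys" "balanced sV sW B"
  shows "tsum xs B = tsum ys B"
  unfolding tsum_def
proof (rule formal_sum_eq_sum_list[OF assms(1)[unfolded tensor_eq_def]])
  fix xs ys assume "tensor_rel sV sW xs ys"
  then show "sum_list (map (\<lambda>(u, v). B u v) xs) = sum_list (map (\<lambda>(u, v). B u v) ys)"
    using assms(2) balanced_zero[OF assms(2)] by cases (auto simp: balanced_def)
qed

lemma tensor3_eq_tsum3:
  assumes "tensor3_eq s xs ys" "balanced3 s T"
  shows "tsum3 xs T = tsum3 ys T"
  unfolding tsum3_def
proof (rule formal_sum_eq_sum_list[OF assms(1)[unfolded tensor3_eq_def]])
  have b: "balanced s s (\<lambda>u v. T u v w)" "balanced s s (T u)" for u w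
    using assms(2) by (auto simp: balanced3_def)
  fix xs ys assume "tensor3_rel s xs ys"
  then show "sum_list (map (\<lambda>(u, v, w). T u v w) xs) = sum_list (map (\<lambda>(u, v, w). T u v w) ys)"
    using b balanced_zero[OF b(1)] balanced_zero[OF b(2)]
    by cases (auto simp: balanced_def)
qed

section \<open>Sums over the comultiplication of a Hopf algebra\<close>

lemma linearD:
  assumes "Vector_Spaces.linear s1 s2 f"
  shows "f (x + y) = f x + f y" "f (s1 c x) = s2 c (f x)"
  using assms by (simp_all add: Vector_Spaces.linear_iff)

context hopf_algebra
begin

lemmas linear_antipode_simps [simp] =
  linearD[OF linear_antipode] linearD[OF linear_counit]

lemma tsum_comult_mult:
  assumes "balanced scale scale B"
  shows "tsum (comult (g * h)) B
    = tsum (comult g) (\<lambda>u v. tsum (comult h) (\<lambda>u' v'. B (u * u') (v * v')))"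
proof -
  have "tsum (concat (map (\<lambda>(u, v). map (\<lambda>(u', v'). (u * u', v * v')) ys) xs)) B
    = tsum xs (\<lambda>u v. tsum ys (\<lambda>u' v'. B (u * u') (v * v')))" for xs ys
    by (induction xs) auto
  then show ?thesis using tensor_eq_tsum[OF comult_mult assms, of g h] by simp
qed

lemma tsum_comult_one: "balanced scale scale B \<Longrightarrow> tsum (comult 1) B = B 1 1"
  using tensor_eq_tsum[OF comult_one] by force

lemma tsum_coassoc:
  assumes "balanced3 scale T"
  shows "tsum (comult h) (\<lambda>u v. tsum (comult u) (\<lambda>u1 u2. T u1 u2 v))
    = tsum (comult h) (\<lambda>u v. tsum (comult v) (T u))"
proof -
  have 1: "tsum3 (concat (map (\<lambda>(u, v). map (\<lambda>(u1, u2). (u1, u2, v)) (comult u)) xs)) T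
     = tsum xs (\<lambda>u v. tsum (comult u) (\<lambda>u1 u2. T u1 u2 v))" for xs
    by (induction xs) (auto simp: tsum3_def tsum_def comp_def split_def)
  have 2: "tsum3 (concat (map (\<lambda>(u, v). map (Pair u) (comult v)) xs)) T
     = tsum xs (\<lambda>u v. tsum (comult v) (T u))" for xs
    by (induction xs) (auto simp: tsum3_def tsum_def comp_def split_def)
  show ?thesis using tensor3_eq_tsum3[OF coassoc assms, of h] by (simp add: 1 2)
qed

lemma tsum_counit_left:
  assumes "\<And>x y. f (x + y) = f x + (f y :: 'x::ab_group_add)"
  shows "tsum (comult h) (\<lambda>u v. f (scale (counit u) v)) = f h"
  using tsum_hom[of f, OF assms, of "comult h" "\<lambda>u v. scale (counit u) v"] counit_left[of h]
  by (simp add: tsum_def)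

lemma tsum_counit_right:
  assumes "\<And>x y. f (x + y) = f x + (f y :: 'x::ab_group_add)"
  shows "tsum (comult h) (\<lambda>u v. f (scale (counit v) u)) = f h"
  using tsum_hom[of f, OF assms, of "comult h" "\<lambda>u v. scale (counit v) u"] counit_right[of h]
  by (simp add: tsum_def)

lemma tsum_antipode_left:
  assumes "\<And>x y. f (x + y) = f x + (f y :: 'x::ab_group_add)"
  shows "tsum (comult h) (\<lambda>u v. f (antipode u * v)) = f (scale (counit h) 1)"
  using tsum_hom[of f, OF assms, of "comult h" "\<lambda>u v. antipode u * v"] antipode_left[of h]
  by (simp add: tsum_def)

lemma tsum_antipode_right:
  assumes "\<And>x y. f (x + y) = f x + (f y :: 'x::ab_group_add)"
  shows "tsum (comult h) (\<lambda>u v. f (u * antipode v)) = f (scale (counit h) 1)"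
  using tsum_hom[of f, OF assms, of "comult h" "\<lambda>u v. u * antipode v"] antipode_right[of h]
  by (simp add: tsum_def)

lemma balanced3I:
  assumes "\<And>u u' v w. T (u + u') v w = T u v w + T u' v w"
    "\<And>u v v' w. T u (v + v') w = T u v w + T u v' w"
    "\<And>u v w w'. T u v (w + w') = T u v w + T u v w'"
    "\<And>c u v w. T (scale c u) v w = T u (scale c v) w"
    "\<And>c u v w. T u (scale c v) w = T u v (scale c w)"
  shows "balanced3 scale T"
  using assms by (simp add: balanced3_def balanced_def)

text \<open>
  In Sweedler notation, \<open>\<Sum> h\<^sub>1 \<otimes> h\<^sub>2 S(h\<^sub>3) = h \<otimes> 1\<close>, and \<open>\<Sum> S(h\<^sub>1) h\<^sub>2 \<otimes> h\<^sub>3 = 1 \<otimes> h\<close> for the next lemma. Read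
  from right to left, these identities introduce the three factors that a computation with the
  antipode needs; coassociativity then regroups them.
\<close>

lemma antipode_cancel_right:
  assumes "balanced scale scale B"
  shows "tsum (comult h) (\<lambda>u v. tsum (comult v) (\<lambda>v1 v2. B u (v1 * antipode v2))) = B h 1"
proof -
  have "tsum (comult h) (\<lambda>u v. B u (scale (counit v) 1)) = B h 1"
    using tsum_counit_right[of "\<lambda>u. B u 1" h] assms by (simp add: balanced_def)
  then show ?thesis using assms by (simp add: tsum_antipode_right balanced_def)
qed

lemma antipode_cancel_left:
  assumes "balanced scale scale B"
  shows "tsum (comult h) (\<lambda>u v. tsum (comult u) (\<lambda>u1 u2. B (antipode u1 * u2) v)) = B 1 h"
proof -
  have "tsum (comult h) (\<lambda>u v. B (scale (counit u) 1) v) = B 1 h"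
    using tsum_counit_left[of "\<lambda>v. B 1 v" h] assms by (simp add: balanced_def)
  then show ?thesis
    using assms by (simp add: tsum_antipode_left[of "\<lambda>x. B x _"] balanced_def)
qed

lemma antipode_one: "antipode 1 = 1"
proof -
  have "tsum (comult 1) (\<lambda>u v. antipode u * v) = antipode 1 * 1"
    by (rule tsum_comult_one) (simp add: balanced_def algebra_simps scale_mult_left scale_mult_right)
  then show ?thesis using antipode_left[of 1] by (simp add: tsum_def counit_one)
qed

lemma counit_antipode: "counit (antipode h) = counit h"
proof -
  have "tsum (comult h) (\<lambda>u v. counit (antipode u * v)) = counit h"
    by (subst tsum_antipode_left) (auto simp: counit_one)
  moreover have "tsum (comult h) (\<lambda>u v. counit (antipode u * v))
      = tsum (comult h) (\<lambda>u v. counit (antipode (scale (counit v) u)))"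
    by (intro tsum_cong) (simp add: counit_mult mult.commute)
  moreover have "\<dots> = counit (antipode h)" by (rule tsum_counit_right) simp
  ultimately show ?thesis by simp
qed

text \<open>
  Both sides equal \<open>\<Sum> S(g\<^sub>1 h\<^sub>1) g\<^sub>2 h\<^sub>2 S(h\<^sub>3) S(g\<^sub>3)\<close>: cancelling \<open>h\<^sub>2 S(h\<^sub>3)\<close> and then
  \<open>g\<^sub>2 S(g\<^sub>3)\<close> leaves \<open>S(g h)\<close>, while \<open>\<Sum> S(g\<^sub>1 h\<^sub>1) (g\<^sub>2 h\<^sub>2)\<close> is a counit and leaves \<open>S(h) S(g)\<close>.
\<close>

lemma antipode_mult: "antipode (g * h) = antipode h * antipode g"
proof -
  let ?S = antipode
  note lin = algebra_simps scale_mult_left scale_mult_right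
  define T where "T v1 v2 x = tsum (comult h) (\<lambda>p q. tsum (comult q) (\<lambda>q1 q2.
    ?S (x * p) * v1 * (q1 * ?S q2) * ?S v2))" for v1 v2 x
  have 1: "tsum (comult h) (\<lambda>p q. tsum (comult q) (\<lambda>q1 q2.
    ?S (u * p) * v1 * (q1 * ?S q2) * ?S v2)) = ?S (u * h) * v1 * ?S v2" for u v1 v2
    by (subst antipode_cancel_right[where B="\<lambda>p x. ?S (u * p) * v1 * x * ?S v2"])
       (simp_all add: balanced_def lin)
  have "tsum (comult g) (\<lambda>u v. tsum (comult v) (\<lambda>v1 v2. tsum (comult h) (\<lambda>p q. tsum (comult q) (\<lambda>q1 q2.
    ?S (u * p) * v1 * (q1 * ?S q2) * ?S v2))))
    = tsum (comult g) (\<lambda>u v. tsum (comult v) (\<lambda>v1 v2. ?S (u * h) * (v1 * ?S v2)))"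
    unfolding 1 by (simp add: mult.assoc)
  also have "\<dots> = ?S (g * h)"
    by (subst antipode_cancel_right[where B="\<lambda>u x. ?S (u * h) * x"])
       (simp_all add: balanced_def lin)
  finally have A: "?S (g * h) = tsum (comult g) (\<lambda>u v. tsum (comult v) (\<lambda>v1 v2. 
    tsum (comult h) (\<lambda>p q. tsum (comult q) (\<lambda>q1 q2. ?S (u * p) * v1 * (q1 * ?S q2) * ?S v2))))" ..
  also have "\<dots> = tsum (comult g) (\<lambda>u v. tsum (comult v) (\<lambda>v1 v2. 
    tsum (comult h) (\<lambda>p q. tsum (comult p) (\<lambda>p1 p2. ?S (u * p1) * v1 * (p2 * ?S q) * ?S v2))))"
    by (subst tsum_coassoc) (auto intro!: balanced3I simp: lin)
  also have "\<dots> = tsum (comult g) (\<lambda>u v. tsum (comult u) (\<lambda>u1 u2. 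
    tsum (comult h) (\<lambda>p q. tsum (comult p) (\<lambda>p1 p2. ?S (u1 * p1) * u2 * (p2 * ?S q) * ?S v))))"
    by (rule tsum_coassoc[symmetric], rule balanced3I) (simp_all add: lin tsum_add)
  also have "\<dots> = tsum (comult g) (\<lambda>u v. tsum (comult h) (\<lambda>p q. 
     tsum (comult u) (\<lambda>u1 u2. tsum (comult p) (\<lambda>p1 p2. ?S (u1 * p1) * (u2 * p2))) * (?S q * ?S v)))"
    by (simp add: tsum_mult_right mult.assoc tsum_swap[of "comult h" "comult _"])
  also have "\<dots> = tsum (comult g) (\<lambda>u v. tsum (comult h) (\<lambda>p q. 
     scale (counit (u * p)) (?S q * ?S v)))"
  proof -
    have "tsum (comult u) (\<lambda>u1 u2. tsum (comult p) (\<lambda>p1 p2. ?S (u1 * p1) * (u2 * p2)))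
      = scale (counit (u * p)) 1" for u p
      by (subst tsum_comult_mult[symmetric, where B="\<lambda>x y. ?S x * y"])
         (auto simp: balanced_def lin tsum_antipode_left[of "\<lambda>x. x", simplified])
    then show ?thesis by (simp add: lin)
  qed
  also have "\<dots> = tsum (comult g) (\<lambda>u v. tsum (comult h) (\<lambda>p q. 
     ?S (scale (counit p) q) * ?S (scale (counit u) v)))"
    by (simp add: counit_mult lin)
  also have "\<dots> = tsum (comult g) (\<lambda>u v. ?S h * ?S (scale (counit u) v))"
    by (subst tsum_counit_left) (simp_all add: lin)
  also have "\<dots> = ?S h * ?S g"
    by (subst tsum_counit_left[where f="\<lambda>x. ?S h * ?S x"]) (simp_all add: lin)
  finally show ?thesis .
qed

end

section \<open>Linear algebra in function spaces\<close>

lemma vector_space_times: "vector_space ((*) :: 'k::field \<Rightarrow> 'k \<Rightarrow> 'k)"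
  by unfold_locales (simp_all add: algebra_simps)

lemma vector_space_fun_scale: "vector_space s \<Longrightarrow> vector_space (fun_scale s)"
  by (auto simp: vector_space_def fun_scale_def fun_eq_iff)

lemma fun_subspace_iff:
  assumes "vector_space s"
  shows "module.subspace (fun_scale s) B \<longleftrightarrow> (\<lambda>x. 0) \<in> B \<and>
    (\<forall>f\<in>B. \<forall>g\<in>B. (\<lambda>x. f x + g x) \<in> B) \<and> (\<forall>c. \<forall>f\<in>B. (\<lambda>x. s c (f x)) \<in> B)"
proof -
  interpret F: vector_space "fun_scale s" by (rule vector_space_fun_scale[OF assms])
  show ?thesis by (simp add: F.subspace_def zero_fun_def plus_fun_def fun_scale_def)
qed

lemma (in vector_space) separating_functional:
  assumes "independent S" 
  shows "\<exists>l. Vector_Spaces.linear scale (*) l \<and> (\<forall>x\<in>S. l x = f x)"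
proof -
  interpret P: vector_space_pair scale "(*) :: 'a \<Rightarrow> 'a \<Rightarrow> 'a"
    using vector_space_axioms vector_space_times by (rule vector_space_pair.intro)
  show ?thesis using P.linear_independent_extend[OF assms, of f] by auto
qed

lemma sum_fun_apply: "(\<Sum>i\<in>I. f i) x = (\<Sum>i\<in>I. f i x)"
  by (induction I rule: infinite_finite_induct) auto

lemma lin_maps_sum:
  assumes "vector_space s1" "vector_space s2" "module.subspace s1 C" "f \<in> lin_maps s1 C s2"
    and "\<And>i. i \<in> I \<Longrightarrow> x i \<in> C"
  shows "f (\<Sum>i\<in>I. s1 (c i) (x i)) = (\<Sum>i\<in>I. s2 (c i) (f (x i)))"
proof -
  interpret V1: vector_space s1 by fact
  interpret V2: vector_space s2 by fact
  have add: "f (x + y) = f x + f y" and scale: "f (s1 c x) = s2 c (f x)" if "x \<in> C" "y \<in> C" for x y c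
    using assms(4) that by (auto simp: lin_maps_def)
  have zero: "f 0 = 0" using scale[of 0 0 0] V1.subspace_0[OF assms(3)] by simp
  show ?thesis
    using assms(5)
  proof (induction I rule: infinite_finite_induct)
    case (insert i I)
    have "s1 (c i) (x i) \<in> C" "(\<Sum>i\<in>I. s1 (c i) (x i)) \<in> C"
      using insert.prems by (auto intro!: V1.subspace_scale V1.subspace_sum assms(3))
    then show ?case using insert by (simp add: add scale)
  qed (simp_all add: zero)
qed

lemma subspace_dual_space: "module.subspace (fun_scale (*)) (dual_space s V)"
  unfolding fun_subspace_iff[OF vector_space_times]
  by (auto simp: dual_space_def lin_maps_def algebra_simps)

text \<open>
  Gaussian elimination, one coordinate at a time, in the coordinate space \<open>k\<^sup>S\<close>; \<open>B\<close> may live on a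
  larger domain than \<open>S\<close>.
\<close>

lemma double_annihilator:
  fixes B :: "('x \<Rightarrow> 'k::field) set"
  assumes "finite S" "module.subspace (fun_scale (*)) B"
    and "\<And>c. (\<And>g. g \<in> B \<Longrightarrow> (\<Sum>s\<in>S. c s * g s) = 0) \<Longrightarrow> (\<Sum>s\<in>S. c s * l s) = 0"
  shows "\<exists>g\<in>B. \<forall>s\<in>S. g s = l s"
  using assms
proof (induction S arbitrary: B l)
  case empty
  then show ?case by (auto simp: fun_subspace_iff[OF vector_space_times])
next
  case (insert s0 S)
  note sub = insert.prems(1)[unfolded fun_subspace_iff[OF vector_space_times]]
  have sub0: "(\<lambda>x. 0) \<in> B" and sub_add: "(\<lambda>x. f x + g x) \<in> B" and sub_scale: "(\<lambda>x. c * f x) \<in> B"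
    if "f \<in> B" "g \<in> B" for f g c using sub that by auto
  show ?case
  proof (cases "\<exists>g\<in>B. g s0 \<noteq> 0")
    case True
    then obtain g1 where g1: "g1 \<in> B" "g1 s0 \<noteq> 0" by blast
    define g0 where "g0 = (\<lambda>x. inverse (g1 s0) * g1 x)"
    have g0: "g0 \<in> B" "g0 s0 = 1" using g1 sub_scale by (auto simp: g0_def)
    define B' where "B' = {g \<in> B. g s0 = 0}"
    define l' where "l' x = l x - l s0 * g0 x" for x
    have "module.subspace (fun_scale (*)) B'"
      using sub by (auto simp: fun_subspace_iff[OF vector_space_times] B'_def)
    moreover have "(\<Sum>s\<in>S. c s * l' s) = 0"
      if c: "\<And>g. g \<in> B' \<Longrightarrow> (\<Sum>s\<in>S. c s * g s) = 0" for c
    proof -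
      \<comment> \<open>The value at \<open>s0\<close> makes \<open>c'\<close> annihilate \<open>g0\<close> as well.\<close>
      define c' where "c' s = (if s = s0 then - (\<Sum>s\<in>S. c s * g0 s) else c s)" for s
      have ext: "(\<Sum>s\<in>insert s0 S. c' s * f s) = (\<Sum>s\<in>S. c s * (f s - f s0 * g0 s))" for f
      proof -
        have "(\<Sum>s\<in>S. c' s * f s) = (\<Sum>s\<in>S. c s * f s)"
          using insert.hyps by (intro sum.cong) (auto simp: c'_def)
        then show ?thesis using insert.hyps
          by (simp add: c'_def sum_distrib_left sum_distrib_right sum_subtractf algebra_simps)
      qed
      have "(\<Sum>s\<in>insert s0 S. c' s * g s) = 0" if "g \<in> B" for g
      proof -
        have "(\<lambda>s. g s + (- g s0) * g0 s) \<in> B"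
          by (rule sub_add[OF that sub_scale[OF g0(1) that]])
        then have "(\<lambda>s. g s + (- g s0) * g0 s) \<in> B'"
          using g0 by (simp add: B'_def)
        from c[OF this] show ?thesis unfolding ext by simp
      qed
      from insert.prems(2)[OF this] show ?thesis unfolding ext l'_def .
    qed
    ultimately obtain g' where g': "g' \<in> B'" "\<forall>s\<in>S. g' s = l' s"
      using insert.IH[of B' l'] by blast
    have "(\<lambda>s. g' s + l s0 * g0 s) \<in> B"
      using g' g0 sub_add sub_scale by (simp add: B'_def)
    then show ?thesis using g' g0 by (intro bexI[of _ "\<lambda>s. g' s + l s0 * g0 s"]) (auto simp: B'_def l'_def)
  next
    case False
    have "l s0 = 0"
      using insert.prems(2)[of "\<lambda>s. if s = s0 then 1 else 0"] False insert.hyps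
      by (simp add: if_distrib[of "\<lambda>x. x * _"] cong: if_cong)
    moreover have "\<exists>g\<in>B. \<forall>s\<in>S. g s = l s"
    proof (rule insert.IH[OF insert.prems(1)])
      fix c assume "\<And>g. g \<in> B \<Longrightarrow> (\<Sum>s\<in>S. c s * g s) = 0"
      then have "(\<Sum>s\<in>insert s0 S. c s * l s) = 0" using False insert.hyps by (intro insert.prems(2)) auto
      then show "(\<Sum>s\<in>S. c s * l s) = 0" using \<open>l s0 = 0\<close> insert.hyps by simp
    qed
    ultimately show ?thesis using False by auto
  qed
qed

text \<open>
  Functions in the span of finitely many functions are determined by their values at as many suitable
  points: when a function \<open>t\<close> is added and some \<open>f1\<close> in the new span vanishes on the old points but not at \<open>y\<close>, the
  point \<open>y\<close> detects the coefficient of \<open>t\<close>.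
\<close>

lemma finite_determining_set:
  fixes s :: "'k::field \<Rightarrow> 'a::ab_group_add \<Rightarrow> 'a" and T :: "('x \<Rightarrow> 'a) set"
  assumes "vector_space s" "finite T"
  shows "\<exists>D. finite D \<and> D \<subseteq> X \<and>
    (\<forall>f\<in>module.span (fun_scale s) T. (\<forall>x\<in>D. f x = 0) \<longrightarrow> (\<forall>x\<in>X. f x = 0))"
  using assms(2)
proof (induction T)
  case empty
  interpret F: vector_space "fun_scale s" by (rule vector_space_fun_scale[OF assms(1)])
  show ?case by (rule exI[of _ "{}"]) simp
next
  case (insert t T)
  interpret V: vector_space s by fact
  interpret F: vector_space "fun_scale s" by (rule vector_space_fun_scale[OF assms(1)])
  from insert.IH obtain D where D: "finite D" "D \<subseteq> X"
    "\<forall>f\<in>F.span T. (\<forall>x\<in>D. f x = 0) \<longrightarrow> (\<forall>x\<in>X. f x = 0)" by (elim exE conjE)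
  show ?case
  proof (cases "\<forall>f\<in>F.span (insert t T). (\<forall>x\<in>D. f x = 0) \<longrightarrow> (\<forall>x\<in>X. f x = 0)")
    case True
    then show ?thesis using D by blast
  next
    case False
    then obtain f1 y where f1: "f1 \<in> F.span (insert t T)" "\<And>x. x \<in> D \<Longrightarrow> f1 x = 0" "y \<in> X" "f1 y \<noteq> 0"
      by blast
    then obtain c1 where c1: "f1 - fun_scale s c1 t \<in> F.span T" by (auto simp: F.span_insert)
    have "c1 \<noteq> 0"
      using D(3)[rule_format, of f1 y] c1 f1 by auto
    have "f x = 0" if f: "f \<in> F.span (insert t T)" "\<forall>x\<in>insert y D. f x = 0" and x: "x \<in> X" for f x
    proof -
      from f obtain c where c: "f - fun_scale s c t \<in> F.span T" by (auto simp: F.span_insert)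
      define r where "r = c / c1"
      have "(f - fun_scale s c t) - fun_scale s r (f1 - fun_scale s c1 t) \<in> F.span T"
        by (intro F.span_diff F.span_scale c c1)
      moreover have "(f - fun_scale s c t) - fun_scale s r (f1 - fun_scale s c1 t) = f - fun_scale s r f1"
        using \<open>c1 \<noteq> 0\<close> by (simp add: F.scale_right_diff_distrib r_def)
      ultimately have g: "f - fun_scale s r f1 \<in> F.span T" by simp
      have "f z = s r (f1 z)" if "z \<in> X" for z
        using D(3)[rule_format, OF g _ that] f f1 by (simp add: fun_scale_def)
      from this[OF f1(3)] this[OF x] show ?thesis using f(2) f1(4) by auto
    qed
    then show ?thesis using D(1,2) f1(3) by (intro exI[of _ "insert y D"]) blast
  qed
qed

section \<open>Indicator functions and cardinality\<close>

unbundle cardinal_syntax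

lemma card_of_finite_ordLeq_infinite:
  assumes "finite Y" "infinite X"
  shows "|Y| \<le>o |X|"
  using assms ordLeq_total[OF card_of_Well_order card_of_Well_order, of Y X] card_of_ordLeq_finite
  by blast

text \<open>
  Finite sets with \<open>n + 1\<close> elements arise from pairs of an element and a set with \<open>n\<close> elements, so
  there are no more of each size than elements of \<open>X\<close>, and only countably many sizes.
\<close>

lemma card_of_Fpow_ordLeq:
  assumes "infinite X" "|G| \<le>o |X|"
  shows "|Fpow G| \<le>o |X|"
proof -
  define F where "F n = {T. T \<subseteq> G \<and> finite T \<and> card T = n}" for n
  have F: "|F n| \<le>o |X|" for n
  proof (induction n)
    case 0
    have "F 0 = {{}}" by (auto simp: F_def)
    then have "finite (F 0)" by simp
    then show ?case using assms(1) by (rule card_of_finite_ordLeq_infinite)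
  next
    case (Suc n)
    have "F (Suc n) \<subseteq> (\<lambda>(x, T). insert x T) ` (G \<times> F n)"
    proof
      fix T assume "T \<in> F (Suc n)"
      then obtain x T' where "T = insert x T'" "x \<notin> T'" "finite T'" "card T' = n" "T \<subseteq> G"
        by (auto simp: F_def card_Suc_eq_finite)
      then show "T \<in> (\<lambda>(x, T). insert x T) ` (G \<times> F n)" by (auto simp: F_def)
    qed
    then have "|F (Suc n)| \<le>o |(\<lambda>(x, T). insert x T) ` (G \<times> F n)|" by (rule card_of_mono1)
    also have "|(\<lambda>(x, T). insert x T) ` (G \<times> F n)| \<le>o |G \<times> F n|" by (rule card_of_image)
    also have "|G \<times> F n| \<le>o |X|" using card_of_Sigma_ordLeq_infinite[OF assms, of "\<lambda>_. F n"] Suc by simp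
    finally show ?case .
  qed
  have "Fpow G = (\<Union>n\<in>(UNIV::nat set). F n)" by (auto simp: Fpow_def F_def)
  moreover have "|UNIV::nat set| \<le>o |X|" using assms(1) infinite_iff_card_of_nat by blast
  ultimately show ?thesis using card_of_UNION_ordLeq_infinite[OF assms(1), of UNIV F] F by simp
qed

text \<open>
  The counting step behind "the dual of an infinite dimensional space is larger than the space", in
  a form that holds for every field, finite or uncountable. A finite subset of \<open>G\<close> spans
  functions with only finitely many different restrictions \<open>X \<rightarrow> {0, a}\<close>, since finitely many points determine
  them. So the span of \<open>G\<close> provides at most \<open>|X|\<close> of these restrictions, but there are \<open>2\<^bsup>|X|\<^esup>\<close>.
\<close>

lemma indicators_not_in_small_span:
  fixes s :: "'k::field \<Rightarrow> 'a::ab_group_add \<Rightarrow> 'a" and G :: "('x \<Rightarrow> 'a) set"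
  assumes "vector_space s" "infinite X" "|G| \<le>o |X|" "a \<noteq> 0"
    and f: "\<And>P. P \<subseteq> X \<Longrightarrow> f P \<in> module.span (fun_scale s) G"
      "\<And>P x. P \<subseteq> X \<Longrightarrow> x \<in> X \<Longrightarrow> f P x = (if x \<in> P then a else 0)"
  shows False
proof -
  interpret F: vector_space "fun_scale s" by (rule vector_space_fun_scale[OF assms(1)])
  define Q where "Q T = {P. P \<subseteq> X \<and> f P \<in> F.span T}" for T
  have finQ: "finite (Q T)" if "finite T" for T
  proof -
    obtain D where D: "finite D" "D \<subseteq> X"
      "\<forall>f\<in>F.span T. (\<forall>x\<in>D. f x = 0) \<longrightarrow> (\<forall>x\<in>X. f x = 0)"
      using finite_determining_set[OF assms(1) \<open>finite T\<close>, of X] by (elim exE conjE)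
    have "inj_on (\<lambda>P. P \<inter> D) (Q T)"
    proof (rule inj_onI)
      fix P P' assume P: "P \<in> Q T" "P' \<in> Q T" and eq: "P \<inter> D = P' \<inter> D"
      have span: "f P - f P' \<in> F.span T" using P by (auto simp: Q_def intro: F.span_diff)
      have "(f P - f P') x = 0" if "x \<in> X" for x
      proof (rule D(3)[rule_format, OF span _ that])
        fix x assume "x \<in> D"
        then have "x \<in> P \<longleftrightarrow> x \<in> P'" using eq by blast
        then show "(f P - f P') x = 0" using \<open>x \<in> D\<close> D(2) P f(2) by (auto simp: Q_def)
      qed
      then have "x \<in> P \<longleftrightarrow> x \<in> P'" if "x \<in> X" for x
        using that P f(2)[of P x] f(2)[of P' x] \<open>a \<noteq> 0\<close> by (auto simp: Q_def split: if_splits)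
      then show "P = P'" using P by (auto simp: Q_def)
    qed
    moreover have "finite ((\<lambda>P. P \<inter> D) ` Q T)"
      by (rule finite_subset[of _ "Pow D"]) (use D in auto)
    ultimately show ?thesis by (rule finite_imageD[rotated])
  qed
  have "Pow X \<subseteq> (\<Union>T\<in>Fpow G. Q T)"
  proof
    fix P assume "P \<in> Pow X"
    then have P: "P \<subseteq> X" by simp
    from f(1)[OF P] obtain T r where T: "finite T" "T \<subseteq> G" "f P = (\<Sum>t\<in>T. fun_scale s (r t) t)"
      by (auto simp: F.span_explicit)
    then have "f P \<in> F.span T" by (simp add: F.span_sum F.span_scale F.span_base)
    then show "P \<in> (\<Union>T\<in>Fpow G. Q T)" using P T by (auto simp: Fpow_def Q_def)
  qed
  then have "|Pow X| \<le>o |\<Union>T\<in>Fpow G. Q T|" by (rule card_of_mono1)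
  also have "|\<Union>T\<in>Fpow G. Q T| \<le>o |X|"
  proof (rule card_of_UNION_ordLeq_infinite[OF assms(2) card_of_Fpow_ordLeq[OF assms(2,3)]])
    show "\<forall>T\<in>Fpow G. |Q T| \<le>o |X|"
      using finQ assms(2) by (simp add: Fpow_def card_of_finite_ordLeq_infinite)
  qed
  finally show False using card_of_Pow[of X] not_ordLess_ordLeq by blast
qed

section \<open>Galois objects are finite dimensional\<close>

locale galois_object = module_algebra sH comult counit antipode sA act
  for sH :: "'k::field \<Rightarrow> 'h::ring_1 \<Rightarrow> 'h" and comult counit antipode
    and sA :: "'k \<Rightarrow> 'a::ring_1 \<Rightarrow> 'a" and act :: "'h \<Rightarrow> 'a \<Rightarrow> 'a" +
  assumes finite_dim_H: "finite_dim sH"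
    and galois: "galois sH sA act"
begin

lemmas act_simps [simp] =
  linearD[OF linear_act_left] linearD[OF linear_act_right] act_one act_unit

lemmas scale_simps = algebra_simps A.scale_mult_left A.scale_mult_right
  H.scale_mult_left H.scale_mult_right

lemma act_zero [simp]: "act h 0 = 0"
  using linearD(2)[OF linear_act_right, of h 0 0] by simp

lemma act_mult_tsum: "act h (a * b) = tsum (comult h) (\<lambda>u v. act u a * act v b)"
  by (simp add: act_mult tsum_def)

lemma act_tsum: "act h (tsum xs B) = tsum xs (\<lambda>u v. act h (B u v))"
  by (rule tsum_hom) simp

lemma act_sum: "act h (sum f I) = (\<Sum>i\<in>I. act h (f i))"
  by (induction I rule: infinite_finite_induct) simp_all

lemma sA_tsum: "sA c (tsum xs B) = tsum xs (\<lambda>u v. sA c (B u v))"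
  by (rule tsum_hom) (simp add: A.scale_right_distrib)

lemma balanced_galois: "balanced sA sH (\<lambda>a h. a * act h b)"
  by (simp add: balanced_def scale_simps)

lemma the_elem_galois:
  assumes "T \<in> tensor_product sA sH" "xs \<in> T"
  shows "the_elem (galois_map act ` T) = galois_map act xs"
proof -
  have "galois_map act ys = galois_map act xs" if "ys \<in> T" for ys
  proof -
    have "tensor_eq sA sH ys xs"
      using assms that by (auto simp: tensor_product_def quotient_def tensor_eq_def
        intro: formal_sum_eq.intros)
    then show ?thesis using tensor_eq_tsum[OF _ balanced_galois]
      by (force simp: galois_map_def tsum_def fun_eq_iff)
  qed
  then have "galois_map act ` T = {galois_map act xs}" using assms(2) by blast
  then show ?thesis by simp
qed

lemma tensor_class: "{ys. tensor_eq sA sH xs ys} \<in> tensor_product sA sH" "xs \<in> {ys. tensor_eq sA sH xs ys}"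
  by (auto simp: tensor_product_def quotient_def tensor_eq_def intro: formal_sum_eq.refl)

lemma galois_surj:
  assumes "Vector_Spaces.linear sA sA f"
  shows "\<exists>xs. \<forall>b. tsum xs (\<lambda>a h. a * act h b) = f b"
proof -
  obtain T where T: "T \<in> tensor_product sA sH" "f = the_elem (galois_map act ` T)"
    using galois assms by (auto simp: galois_def bij_betw_def)
  then obtain xs where "xs \<in> T"
    by (auto simp: tensor_product_def quotient_def tensor_eq_def intro: formal_sum_eq.refl)
  with T have "f = galois_map act xs" using the_elem_galois by simp
  then show ?thesis by (auto simp: galois_map_def tsum_def)
qed

text \<open>
  Equality of endomorphisms forces equality of tensors; through \<open>B\<close>, the identity can be carried over
  to any other map on \<open>A \<otimes> H\<close>.
\<close>

lemma galois_inj: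
  assumes "\<And>b. tsum xs (\<lambda>a h. a * act h b) = tsum ys (\<lambda>a h. a * act h b)"
    and "balanced sA sH B"
  shows "tsum xs B = tsum ys B"
proof -
  let ?c = "\<lambda>xs. {ys. tensor_eq sA sH xs ys}"
  have "galois_map act xs = galois_map act ys"
    using assms(1) by (auto simp: galois_map_def tsum_def)
  then have "the_elem (galois_map act ` ?c xs) = the_elem (galois_map act ` ?c ys)"
    using the_elem_galois[OF tensor_class] by simp
  then have "?c xs = ?c ys"
    using galois tensor_class unfolding galois_def bij_betw_def inj_on_def by blast
  then have "tensor_eq sA sH xs ys" using tensor_class(2)[of ys] by blast
  then show ?thesis using assms(2) by (rule tensor_eq_tsum)
qed

text \<open>
  Every endomorphism of \<open>A\<close> is a sum of maps \<open>b \<mapsto> a (h b)\<close>, and with \<open>H\<close> finite dimensional these are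
  spanned by those with \<open>a\<close> in a basis \<open>X\<close> of \<open>A\<close> and \<open>h\<close> in a finite set. If \<open>X\<close> were infinite, this
  would be a spanning set of size \<open>|X|\<close>, too small to reach the endomorphisms that send each basis vector to \<open>0\<close> or \<open>1\<close>.
\<close>

lemma finite_dim_A: "finite_dim sA"
proof (rule ccontr)
  assume "\<not> finite_dim sA"
  obtain X where X: "\<not> A.dependent X" "UNIV \<subseteq> A.span X"
    using A.basis_exists by metis
  with \<open>\<not> finite_dim sA\<close> have inf: "infinite X"
    by (auto simp: finite_dim_def top.extremum_unique)
  obtain Y where Y: "finite Y" "H.span Y = UNIV" using finite_dim_H by (auto simp: finite_dim_def)
  interpret F: vector_space "fun_scale sA" by (rule vector_space_fun_scale) unfold_locales
  interpret AA: vector_space_pair sA sA by unfold_locales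
  let ?p = "\<lambda>a h b. a * act h b"
  define G where "G = (\<lambda>(a, h). ?p a h) ` (X \<times> Y)"
  have "|G| \<le>o |X|"
  proof -
    have "|G| \<le>o |X \<times> Y|" unfolding G_def by (rule card_of_image)
    also have "|X \<times> Y| \<le>o |X|"
      using card_of_Sigma_ordLeq_infinite[OF inf, of X "\<lambda>_. Y"] card_of_refl[of X] ordIso_iff_ordLeq
        card_of_finite_ordLeq_infinite[OF Y(1) inf] by blast
    finally show ?thesis .
  qed
  have p: "?p a h \<in> F.span G" for a h
  proof -
    have 1: "?p a h \<in> F.span G" if "a \<in> X" for a h
    proof -
      have "h \<in> H.span Y" by (simp add: Y)
      then show ?thesis
      proof (induction h rule: H.span_induct_alt)
        case base
        have "act 0 b = 0" for b using linearD(2)[OF linear_act_left, of 0 0] by simp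
        then have "?p a 0 = 0" by (simp add: fun_eq_iff)
        then show ?case using F.span_zero by metis
      next
        case (step c y h)
        have "?p a (sH c y + h) = fun_scale sA c (?p a y) + ?p a h"
          by (auto simp: fun_scale_def scale_simps)
        moreover have "?p a y \<in> F.span G" using step(1) that by (intro F.span_base) (auto simp: G_def)
        ultimately show ?case using step(2) by (simp add: F.span_add F.span_scale)
      qed
    qed
    have "a \<in> A.span X" using X(2) by blast
    then show ?thesis
    proof (induction a rule: A.span_induct_alt)
      case base
      have "?p 0 h = 0" by (simp add: fun_eq_iff)
      then show ?case using F.span_zero by metis
    next
      case (step c x a)
      have "?p (sA c x + a) h = fun_scale sA c (?p x h) + ?p a h"
        by (auto simp: fun_scale_def scale_simps)
      then show ?case using step 1 by (simp add: F.span_add F.span_scale)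
    qed
  qed
  define f where "f P = AA.construct X (\<lambda>x. if x \<in> P then 1 else 0)" for P
  have "f P \<in> F.span G" for P
  proof -
    have "Vector_Spaces.linear sA sA (f P)"
      unfolding f_def by (rule AA.linear_construct[OF X(1)])
    then obtain xs where xs: "\<And>b. tsum xs (\<lambda>a h. a * act h b) = f P b"
      using galois_surj by blast
    have "(\<lambda>b. tsum xs (\<lambda>a h. a * act h b)) \<in> F.span G"
    proof (induction xs)
      case Nil
      then show ?case using F.span_zero by (simp add: zero_fun_def)
    next
      case (Cons q xs)
      then show ?case using F.span_add[OF p[of "fst q" "snd q"] Cons] by (simp add: plus_fun_def)
    qed
    then show ?thesis by (simp add: xs)
  qed
  moreover have "f P x = (if x \<in> P then 1 else 0)" if "x \<in> X" for P x
    unfolding f_def by (rule AA.construct_basis[OF X(1) that])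
  ultimately show False
    using indicators_not_in_small_span[OF A.vector_space_axioms inf \<open>|G| \<le>o |X|\<close>, of 1 f] by simp
qed

section \<open>The tensors of the coordinate functions\<close>

definition basis :: "'a set" where "basis = some_basis sA UNIV"

definition coord :: "'a \<Rightarrow> 'a \<Rightarrow> 'k" where "coord e b = A.representation basis b e"

lemma some_basis:
  assumes "A.subspace V"
  shows "\<not> A.dependent (some_basis sA V)" "A.span (some_basis sA V) = V" "finite (some_basis sA V)"
proof -
  have "\<exists>B. \<not> A.dependent B \<and> A.span B = V"
    using A.basis_exists[of V] A.span_minimal[OF _ assms] by (metis subset_antisym)
  then have *: "\<not> A.dependent (some_basis sA V) \<and> A.span (some_basis sA V) = V"
    unfolding some_basis_def by (rule someI_ex)
  then show "\<not> A.dependent (some_basis sA V)" "A.span (some_basis sA V) = V" by auto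
  obtain Y where "finite Y" "A.span Y = UNIV" using finite_dim_A by (auto simp: finite_dim_def)
  then show "finite (some_basis sA V)" using A.independent_span_bound * by auto
qed

lemma basis: "\<not> A.dependent basis" "A.span basis = UNIV" "finite basis"
  using some_basis[OF A.subspace_UNIV] by (auto simp: basis_def)

lemma coord_simps [simp]:
  "coord e (x + y) = coord e x + coord e y" "coord e (sA c x) = c * coord e x"
  by (simp_all add: coord_def A.representation_add A.representation_scale basis)

lemma linear_coord: "Vector_Spaces.linear sA (*) (coord e)"
  by (simp add: Vector_Spaces.linear_iff A.vector_space_axioms vector_space_times)

lemma sum_coord: "(\<Sum>e\<in>basis. sA (coord e b) e) = b"
  unfolding coord_def using A.sum_representation_eq[of basis b basis] basis by simp

lemma coord_eq_0: "(\<And>e. e \<in> basis \<Longrightarrow> coord e b = 0) \<Longrightarrow> b = 0"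
  using sum_coord[of b] by simp

definition coord_tensor :: "'a \<Rightarrow> ('a \<times> 'h) list" where
  "coord_tensor e = (SOME xs. \<forall>b. tsum xs (\<lambda>y g. y * act g b) = sA (coord e b) 1)"

lemma coord_tensor: "tsum (coord_tensor e) (\<lambda>y g. y * act g b) = sA (coord e b) 1"
proof -
  have "Vector_Spaces.linear sA sA (\<lambda>b. sA (coord e b) 1)"
    by (simp add: Vector_Spaces.linear_iff A.vector_space_axioms A.scale_left_distrib)
  from someI_ex[OF galois_surj[OF this]] show ?thesis unfolding coord_tensor_def by blast
qed

text \<open>
  \<open>\<Sum>\<^sub>e (h e) y \<otimes> g = 1 \<otimes> h\<close>, since both tensors act on \<open>b\<close> as \<open>\<Sum>\<^sub>e e\<^sup>*(b) (h e) = h b\<close>.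
\<close>

lemma sum_coord_tensor:
  assumes "balanced sA sH B"
  shows "(\<Sum>e\<in>basis. tsum (coord_tensor e) (\<lambda>y g. B (act h e * y) g)) = B 1 h"
proof -
  obtain L where L: "set L = basis" "distinct L" using finite_distinct_list[OF basis(3)] by blast
  define xs where "xs = concat (map (\<lambda>e. map (\<lambda>(y, g). (act h e * y, g)) (coord_tensor e)) L)"
  have xs: "tsum xs B' = (\<Sum>e\<in>basis. tsum (coord_tensor e) (\<lambda>y g. B' (act h e * y) g))"
    for B' :: "'a \<Rightarrow> 'h \<Rightarrow> 'x::comm_monoid_add"
    using L by (simp add: xs_def tsum_concat sum_list_distinct_conv_sum_set)
  have "tsum xs B = tsum [(1, h)] B"
  proof (rule galois_inj[OF _ assms])
    fix b
    have "tsum xs (\<lambda>a h. a * act h b) = (\<Sum>e\<in>basis. act h e * sA (coord e b) 1)"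
      by (simp add: xs mult.assoc tsum_mult_left[symmetric] coord_tensor)
    also have "\<dots> = act h (\<Sum>e\<in>basis. sA (coord e b) e)"
      by (simp add: act_sum A.scale_mult_right)
    finally show "tsum xs (\<lambda>a h. a * act h b) = tsum [(1, h)] (\<lambda>a h. a * act h b)"
      by (simp add: sum_coord)
  qed
  then show ?thesis by (simp add: xs)
qed

text \<open>
  \<open>\<Sum> k' y \<otimes> k'' g = \<epsilon>(k) y \<otimes> g\<close>, since both sides act on \<open>b\<close> as \<open>k\<close> applied to the invariant
  \<open>e\<^sup>*(b) 1\<close>.
\<close>

lemma coord_tensor_invariant:
  assumes "balanced sA sH B"
  shows "tsum (coord_tensor e) (\<lambda>y g. tsum (comult k) (\<lambda>k1 k2. B (act k1 y) (k2 * g)))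
    = tsum (coord_tensor e) (\<lambda>y g. B (sA (counit k) y) g)"
proof -
  define xs where "xs = concat (map (\<lambda>(y, g). map (\<lambda>(k1, k2). (act k1 y, k2 * g)) (comult k)) (coord_tensor e))"
  define ys where "ys = map (\<lambda>(y, g). (sA (counit k) y, g)) (coord_tensor e)"
  have "tsum xs B = tsum ys B"
  proof (rule galois_inj[OF _ assms])
    fix b
    have "tsum xs (\<lambda>a h. a * act h b) = act k (sA (coord e b) 1)"
      unfolding coord_tensor[symmetric] act_tsum
      by (simp add: xs_def tsum_concat_pairs act_mult_tsum act_act)
    also have "\<dots> = sA (counit k) (sA (coord e b) 1)" by (simp add: mult.commute)
    also have "\<dots> = tsum ys (\<lambda>a h. a * act h b)"
      unfolding coord_tensor[symmetric] sA_tsum by (simp add: ys_def A.scale_mult_left)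
    finally show "tsum xs (\<lambda>a h. a * act h b) = tsum ys (\<lambda>a h. a * act h b)" .
  qed
  then show ?thesis by (simp add: xs_def ys_def tsum_concat_pairs)
qed

text \<open>
  Invariance in the form in which it is used: \<open>k\<close> acting on one factor is moved to the other one. It
  follows from \<open>y \<otimes> k g = \<Sum> S(k\<^sub>1) k\<^sub>2 y \<otimes> k\<^sub>3 g\<close>.
\<close>

lemma coord_tensor_antipode:
  assumes B: "balanced sA sH B"
  shows "tsum (coord_tensor e) (\<lambda>y g. B (act (antipode k) y) g) = tsum (coord_tensor e) (\<lambda>y g. B y (k * g))"
proof -
  note Bs = B[unfolded balanced_def]
  have bu: "balanced sA sH (\<lambda>y. B (act (antipode u) y))" for u
    using Bs by (simp add: balanced_def)
  have "tsum (coord_tensor e) (\<lambda>y g. B y (k * g))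
    = tsum (coord_tensor e) (\<lambda>y g. tsum (comult k) (\<lambda>u v. tsum (comult u) (\<lambda>u1 u2.
        B (act (antipode u1 * u2) y) (v * g))))"
    by (subst H.antipode_cancel_left[where B="\<lambda>x v. B (act x y) (v * g)" for y g])
       (use Bs in \<open>simp_all add: balanced_def scale_simps\<close>)
  also have "\<dots> = tsum (coord_tensor e) (\<lambda>y g. tsum (comult k) (\<lambda>u v. tsum (comult v) (\<lambda>v1 v2.
        B (act (antipode u * v1) y) (v2 * g))))"
    by (subst H.tsum_coassoc) (use Bs in \<open>auto intro!: H.balanced3I simp: scale_simps\<close>)
  also have "\<dots> = tsum (comult k) (\<lambda>u v. tsum (coord_tensor e) (\<lambda>y g. tsum (comult v) (\<lambda>v1 v2.
        B (act (antipode u) (act v1 y)) (v2 * g))))"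
    by (simp add: act_act tsum_swap[of "coord_tensor e"])
  also have "\<dots> = tsum (comult k) (\<lambda>u v. tsum (coord_tensor e) (\<lambda>y g.
        B (act (antipode (sH (counit v) u)) y) g))"
    using coord_tensor_invariant[OF bu] by simp
  also have "\<dots> = tsum (coord_tensor e) (\<lambda>y g. tsum (comult k) (\<lambda>u v.
        B (act (antipode (sH (counit v) u)) y) g))"
    by (rule tsum_swap)
  also have "\<dots> = tsum (coord_tensor e) (\<lambda>y g. B (act (antipode k) y) g)"
    by (subst H.tsum_counit_right[where f="\<lambda>u. B (act (antipode u) y) g" for y g]) (use Bs in simp_all)
  finally show ?thesis ..
qed

section \<open>Bijectivity of the antipode and invariants\<close>

text \<open>
  The elements \<open>z e\<close> satisfy \<open>\<Sum>\<^sub>e (h e) z\<^sub>e = \<chi>(h) 1\<close> by \<open>sum_coord_tensor\<close>. Now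
  \<open>\<Sum> h' (e \<cdot> S(h'') x) = (h e) x\<close> and hence \<open>e \<cdot> S(h) x = \<Sum> S(h') ((h'' e) x)\<close>, so the sum below is
  \<open>\<Sum> S(h') (\<chi>(h'') 1) = \<chi>(h) 1\<close>.
\<close>

lemma functional_factors_through_antipode:
  assumes "Vector_Spaces.linear sH (*) \<chi>"
  defines "z \<equiv> \<lambda>e. tsum (coord_tensor e) (\<lambda>y g. sA (\<chi> g) y)"
  shows "(\<Sum>e\<in>basis. e * act (antipode h) (z e)) = sA (\<chi> h) 1"
proof -
  let ?S = antipode
  note chi = linearD[OF assms(1)]
  have z: "(\<Sum>e\<in>basis. act v e * z e) = sA (\<chi> v) 1" for v
    using sum_coord_tensor[of "\<lambda>y g. sA (\<chi> g) y" v]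
    by (simp add: balanced_def scale_simps chi z_def tsum_mult_left mult.commute)
  have a: "tsum (comult v) (\<lambda>v1 v2. act v1 (e * act (?S v2) x)) = act v e * x" for v e x
  proof -
    have "tsum (comult v) (\<lambda>v1 v2. act v1 (e * act (?S v2) x))
      = tsum (comult v) (\<lambda>v1 v2. tsum (comult v1) (\<lambda>p q. act p e * act (q * ?S v2) x))"
      by (simp add: act_mult_tsum act_act)
    also have "\<dots> = tsum (comult v) (\<lambda>p w. tsum (comult w) (\<lambda>q v2. act p e * act (q * ?S v2) x))"
      by (rule H.tsum_coassoc) (auto intro!: H.balanced3I simp: scale_simps)
    also have "\<dots> = act v e * x"
      by (subst H.antipode_cancel_right[where B="\<lambda>p w. act p e * act w x"])
         (simp_all add: balanced_def scale_simps)
    finally show ?thesis .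
  qed
  have b: "e * act (?S h) x = tsum (comult h) (\<lambda>u v. act (?S u) (act v e * x))" for e x
  proof -
    have "e * act (?S h) x
      = tsum (comult h) (\<lambda>u v. tsum (comult u) (\<lambda>u1 u2. act (?S u1 * u2) (e * act (?S v) x)))"
      by (subst H.antipode_cancel_left[where B="\<lambda>w v. act w (e * act (?S v) x)"])
         (simp_all add: balanced_def scale_simps)
    also have "\<dots> = tsum (comult h) (\<lambda>u v. tsum (comult v) (\<lambda>v1 v2. act (?S u * v1) (e * act (?S v2) x)))"
      by (rule H.tsum_coassoc) (auto intro!: H.balanced3I simp: scale_simps)
    also have "\<dots> = tsum (comult h) (\<lambda>u v. act (?S u) (act v e * x))"
      by (simp add: act_act act_tsum[symmetric] a)
    finally show ?thesis .
  qed
  have "(\<Sum>e\<in>basis. e * act (?S h) (z e)) = tsum (comult h) (\<lambda>u v. act (?S u) (\<Sum>e\<in>basis. act v e * z e))"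
    by (simp add: b tsum_sum[symmetric] act_sum)
  also have "\<dots> = tsum (comult h) (\<lambda>u v. sA (\<chi> (sH (counit u) v)) 1)"
    by (simp add: z H.counit_antipode chi mult.commute)
  also have "\<dots> = sA (\<chi> h) 1"
    by (rule H.tsum_counit_left) (simp add: chi A.scale_left_distrib)
  finally show ?thesis .
qed

text \<open>
  All functionals on \<open>H\<close> vanish on the kernel of \<open>S\<close>, because their values at \<open>h\<close> depend only on
  \<open>S(h)\<close>.
\<close>

lemma bij_antipode: "bij antipode"
proof -
  have ker: "g = 0" if "antipode g = 0" for g
  proof (rule ccontr)
    assume "g \<noteq> 0"
    then obtain \<chi> where \<chi>: "Vector_Spaces.linear sH (*) \<chi>" "\<chi> g = 1"
      using H.separating_functional[of "{g}" "\<lambda>_. 1"] by auto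
    have "act 0 x = 0" for x using linearD(2)[OF linear_act_left, of 0 0] by simp
    then show False using functional_factors_through_antipode[OF \<chi>(1), of g] \<chi>(2) that by simp
  qed
  have lin: "Vector_Spaces.linear sH sH antipode" by (rule H.linear_antipode)
  have inj: "inj antipode"
  proof (rule injI)
    fix x y assume "antipode x = antipode y"
    then have "antipode (x + sH (- 1) y) = 0"
      by (simp only: H.linear_antipode_simps) simp
    from ker[OF this] show "x = y" by simp
  qed
  obtain Y where Y: "finite Y" "H.span Y = UNIV" using finite_dim_H by (auto simp: finite_dim_def)
  obtain Z where Z: "\<not> H.dependent Z" "UNIV \<subseteq> H.span Z" by (metis H.basis_exists)
  then have "finite Z" using H.independent_span_bound[OF Y(1) Z(1)] Y(2) by simp
  interpret HF: finite_dimensional_vector_space sH Z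
    using Z \<open>finite Z\<close> by unfold_locales auto
  from HF.linear_inj_imp_surj[OF lin inj] inj show ?thesis by (simp add: bij_def)
qed

lemma inv_antipode [simp]: "antipode (inv antipode h) = h" "inv antipode (antipode h) = h"
  using bij_antipode by (simp_all add: bij_is_inj bij_is_surj surj_f_inv_f)

text \<open>
  If \<open>a\<close> is invariant, then \<open>f(a) = f(1) a\<close> for all maps \<open>f(b) = \<Sum> x (h b)\<close>, that is, for all
  endomorphisms; one with \<open>f(1) = 0\<close> and \<open>f(a) = 1\<close> exists unless \<open>a\<close> is a scalar.
\<close>

lemma invariant_imp_scalar:
  assumes "\<And>h. act h a = sA (counit h) a"
  shows "\<exists>c. a = sA c 1"
proof (rule ccontr)
  assume "\<nexists>c. a = sA c 1"
  then have a: "a \<notin> A.span {1}" by (auto simp: A.span_singleton)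
  then have "\<not> A.dependent {a, 1}" by (simp add: A.independent_insert)
  from A.separating_functional[OF this, of "\<lambda>x. if x = 1 then 0 else 1"]
  obtain l where l: "Vector_Spaces.linear sA (*) l" "\<forall>x\<in>{a, 1}. l x = (if x = 1 then 0 else 1)"
    by blast
  have "a \<noteq> 1" using a A.span_base[of 1 "{1}"] by blast
  then have l1: "l 1 = 0" "l a = 1" using l(2) by simp_all
  have "Vector_Spaces.linear sA sA (\<lambda>b. sA (l b) 1)"
    using linearD[OF l(1)]
    by (simp add: Vector_Spaces.linear_iff A.vector_space_axioms A.scale_left_distrib)
  then obtain xs where xs: "\<And>b. tsum xs (\<lambda>x h. x * act h b) = sA (l b) 1" using galois_surj by blast
  have "1 = tsum xs (\<lambda>x h. x * act h a)" by (simp add: xs l1)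
  also have "\<dots> = tsum xs (\<lambda>x h. x * act h 1) * a"
    by (simp add: assms tsum_mult_right A.scale_mult_left A.scale_mult_right)
  also have "\<dots> = 0" by (simp only: xs l1) simp
  finally show False by simp
qed

lemma scalar_of_scale [simp]: "scalar_of sA (sA c 1) = c"
  unfolding scalar_of_def by (rule the_equality) auto

section \<open>A basis of the equivariant endomorphisms is a basis of End A over A\<close>

lemma End_H_iff:
  "\<phi> \<in> End_H sA act \<longleftrightarrow> (\<forall>x y. \<phi> (x + y) = \<phi> x + \<phi> y) \<and> (\<forall>c x. \<phi> (sA c x) = sA c (\<phi> x)) \<and>
    (\<forall>h x. \<phi> (act h x) = act h (\<phi> x))"
  by (auto simp: End_H_def H_hom_def lin_maps_def)

lemma End_H_linear: "\<phi> \<in> End_H sA act \<Longrightarrow> Vector_Spaces.linear sA sA \<phi>"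
  by (simp add: End_H_iff Vector_Spaces.linear_iff A.vector_space_axioms)

lemma id_End_H: "(\<lambda>x. x) \<in> End_H sA act"
  by (simp add: End_H_iff)

text \<open>
  From \<open>k x \<cdot> \<psi>(b) = \<Sum> k\<^sub>1 x \<cdot> k\<^sub>2 S(k\<^sub>3) \<psi>(b)\<close> and the linearity of \<open>\<psi>\<close> over \<open>H\<close>. A linear relation between maps
  \<open>b \<mapsto> x \<psi>(b)\<close> is thus preserved when \<open>k\<close> is applied to the coefficients \<open>x\<close>.
\<close>

lemma act_mult_End_H:
  assumes "\<psi> \<in> End_H sA act"
  shows "act k x * \<psi> b = tsum (comult k) (\<lambda>u v. act u (x * \<psi> (act (antipode v) b)))"
proof -
  have "act k x * \<psi> b = tsum (comult k) (\<lambda>u v. tsum (comult v) (\<lambda>v1 v2. 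
      act u x * act (v1 * antipode v2) (\<psi> b)))"
    by (subst H.antipode_cancel_right[where B="\<lambda>u w. act u x * act w (\<psi> b)"])
       (simp_all add: balanced_def scale_simps)
  also have "\<dots> = tsum (comult k) (\<lambda>u v. tsum (comult u) (\<lambda>u1 u2. 
      act u1 x * act (u2 * antipode v) (\<psi> b)))"
    by (rule H.tsum_coassoc[symmetric]) (auto intro!: H.balanced3I simp: scale_simps)
  finally show ?thesis using assms by (simp add: act_mult_tsum act_act End_H_iff)
qed

text \<open>
  The functional \<open>l\<close> is averaged over the coordinate tensor of \<open>e\<close>, which makes it \<open>H\<close>-linear.
\<close>

definition functional_endo :: "'a \<Rightarrow> ('a \<Rightarrow> 'k) \<Rightarrow> 'a \<Rightarrow> 'a" where
  "functional_endo e l b = tsum (coord_tensor e) (\<lambda>y g. sA (l (act (antipode g) b)) y)"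

lemma functional_endo_in_End_H:
  assumes "Vector_Spaces.linear sA (*) l"
  shows "functional_endo e l \<in> End_H sA act"
proof -
  note l = linearD[OF assms]
  have "functional_endo e l (act (antipode k) b) = act (antipode k) (functional_endo e l b)" for k b
    unfolding functional_endo_def act_tsum
    by (simp, subst coord_tensor_antipode)
       (simp_all add: balanced_def scale_simps l H.antipode_mult act_act)
  then have "functional_endo e l (act k b) = act k (functional_endo e l b)" for k b
    by (metis inv_antipode(1))
  then show ?thesis
    by (simp add: End_H_iff functional_endo_def l A.scale_left_distrib tsum_add sA_tsum)
qed

lemma sum_functional_endo:
  assumes "Vector_Spaces.linear sA (*) l"
  shows "(\<Sum>e\<in>basis. e * functional_endo e l b) = sA (l b) 1"
  using sum_coord_tensor[of "\<lambda>y g. sA (l (act (antipode g) b)) y" 1] linearD[OF assms]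
  by (simp add: balanced_def scale_simps functional_endo_def tsum_mult_left H.antipode_one)

lemma endo_eq_sum_functional_endo:
  assumes "Vector_Spaces.linear sA sA f"
  shows "f b = (\<Sum>d\<in>basis. \<Sum>e\<in>basis. f d * e * functional_endo e (coord d) b)"
proof -
  interpret f: Vector_Spaces.linear sA sA f by fact
  have "f b = f (\<Sum>d\<in>basis. sA (coord d b) d)" by (simp add: sum_coord)
  also have "\<dots> = (\<Sum>d\<in>basis. f d * sA (coord d b) 1)"
    by (simp add: f.sum f.scale A.scale_mult_right)
  also have "\<dots> = (\<Sum>d\<in>basis. f d * (\<Sum>e\<in>basis. e * functional_endo e (coord d) b))"
    by (simp add: sum_functional_endo linear_coord)
  finally show ?thesis by (simp add: sum_distrib_left mult.assoc)
qed

sublocale F: vector_space "fun_scale sA :: 'k \<Rightarrow> ('a \<Rightarrow> 'a) \<Rightarrow> 'a \<Rightarrow> 'a"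
  by (rule vector_space_fun_scale) unfold_locales

definition E_basis :: "('a \<Rightarrow> 'a) set" where "E_basis = some_basis (fun_scale sA) (End_H sA act)"

lemma subspace_End_H: "F.subspace (End_H sA act)"
  unfolding fun_subspace_iff[OF A.vector_space_axioms]
  by (simp add: End_H_iff algebra_simps A.scale_right_distrib)

lemma E_basis: "\<not> F.dependent E_basis" "F.span E_basis = End_H sA act" "finite E_basis"
proof -
  have "\<exists>B. \<not> F.dependent B \<and> F.span B = End_H sA act"
    using F.basis_exists[of "End_H sA act"] F.span_minimal[OF _ subspace_End_H] by (metis subset_antisym)
  then have *: "\<not> F.dependent E_basis \<and> F.span E_basis = End_H sA act"
    unfolding E_basis_def some_basis_def by (rule someI_ex)
  then show "\<not> F.dependent E_basis" "F.span E_basis = End_H sA act" by auto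
  let ?T = "(\<lambda>(c, d) b. sA (coord d b) c) ` (basis \<times> basis)"
  have "End_H sA act \<subseteq> F.span ?T"
  proof
    fix \<phi> assume "\<phi> \<in> End_H sA act"
    then interpret f: Vector_Spaces.linear sA sA \<phi> by (rule End_H_linear)
    have "\<phi> = (\<Sum>d\<in>basis. \<Sum>c\<in>basis. fun_scale sA (coord c (\<phi> d)) (\<lambda>b. sA (coord d b) c))"
    proof
      fix b
      have "\<phi> b = \<phi> (\<Sum>d\<in>basis. sA (coord d b) d)" by (simp add: sum_coord)
      also have "\<dots> = (\<Sum>d\<in>basis. sA (coord d b) (\<phi> d))"
        by (simp only: f.sum f.scale)
      also have "\<dots> = (\<Sum>d\<in>basis. sA (coord d b) (\<Sum>c\<in>basis. sA (coord c (\<phi> d)) c))"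
        by (simp only: sum_coord)
      finally show "\<phi> b
          = (\<Sum>d\<in>basis. \<Sum>c\<in>basis. fun_scale sA (coord c (\<phi> d)) (\<lambda>b. sA (coord d b) c)) b"
        by (simp only: A.scale_sum_right fun_scale_def sum_fun_apply A.scale_scale mult.commute)
    qed
    also have "\<dots> \<in> F.span ?T"
      by (intro F.span_sum F.span_scale F.span_base) auto
    finally show "\<phi> \<in> F.span ?T" .
  qed
  moreover have "finite ?T" using basis(3) by simp
  ultimately show "finite E_basis"
    using F.independent_span_bound[of ?T E_basis] * F.span_superset[of E_basis] by auto
qed

lemma E_basis_End_H: "\<psi> \<in> E_basis \<Longrightarrow> \<psi> \<in> End_H sA act"
  using E_basis(2) F.span_base by blast

lemma End_H_expand:
  assumes "\<phi> \<in> End_H sA act"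
  shows "(\<Sum>\<psi>\<in>E_basis. sA (F.representation E_basis \<phi> \<psi>) (\<psi> b)) = \<phi> b"
proof -
  have "(\<Sum>\<psi>\<in>E_basis. fun_scale sA (F.representation E_basis \<phi> \<psi>) \<psi>) = \<phi>"
    using F.sum_representation_eq[of E_basis \<phi> E_basis] E_basis assms by simp
  from fun_cong[OF this, of b] show ?thesis by (simp add: sum_fun_apply fun_scale_def)
qed

definition E_coeff :: "('a \<Rightarrow> 'a) \<Rightarrow> ('a \<Rightarrow> 'a) \<Rightarrow> 'a" where
  "E_coeff \<psi> f = (\<Sum>d\<in>basis. \<Sum>e\<in>basis.
    sA (F.representation E_basis (functional_endo e (coord d)) \<psi>) (f d * e))"

text \<open>
  \<open>E\<close> spans \<open>End A\<close> over \<open>A\<close>: the maps \<open>functional_endo e (coord d)\<close>, which lie in \<open>E\<close>, already do so.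
\<close>

lemma sum_E_coeff:
  assumes "Vector_Spaces.linear sA sA f"
  shows "(\<Sum>\<psi>\<in>E_basis. E_coeff \<psi> f * \<psi> b) = f b"
proof -
  have "f b = (\<Sum>d\<in>basis. \<Sum>e\<in>basis. f d * e * (\<Sum>\<psi>\<in>E_basis.
      sA (F.representation E_basis (functional_endo e (coord d)) \<psi>) (\<psi> b)))"
    by (simp add: End_H_expand functional_endo_in_End_H linear_coord endo_eq_sum_functional_endo[OF assms, of b])
  also have "\<dots> = (\<Sum>d\<in>basis. \<Sum>e\<in>basis. \<Sum>\<psi>\<in>E_basis.
      sA (F.representation E_basis (functional_endo e (coord d)) \<psi>) (f d * e) * \<psi> b)"
    by (simp add: sum_distrib_left A.scale_mult_left A.scale_mult_right)
  also have "\<dots> = (\<Sum>d\<in>basis. \<Sum>\<psi>\<in>E_basis. \<Sum>e\<in>basis. 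
      sA (F.representation E_basis (functional_endo e (coord d)) \<psi>) (f d * e) * \<psi> b)"
    by (rule sum.cong[OF HOL.refl]) (rule sum.swap)
  also have "\<dots> = (\<Sum>\<psi>\<in>E_basis. E_coeff \<psi> f * \<psi> b)"
    by (subst sum.swap) (simp add: E_coeff_def sum_distrib_right)
  finally show ?thesis ..
qed

text \<open>
  The set of coefficient families of relations is stable under the action of \<open>H\<close> (\<open>act_mult_End_H\<close>) and
  under left multiplication, hence under all endomorphisms of \<open>A\<close>. Applying \<open>e\<^sup>*\<close> to the coefficients
  yields a linear relation over the field.
\<close>

lemma E_basis_free:
  assumes "\<And>b. (\<Sum>\<psi>\<in>E_basis. a \<psi> * \<psi> b) = 0" and "\<psi> \<in> E_basis"
  shows "a \<psi> = 0"
proof (rule coord_eq_0)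
  fix e assume "e \<in> basis"
  have act_zero_sum: "(\<Sum>\<psi>\<in>E_basis. act k (a \<psi>) * \<psi> b) = 0" for k b
  proof -
    have "(\<Sum>\<psi>\<in>E_basis. act k (a \<psi>) * \<psi> b)
      = tsum (comult k) (\<lambda>u v. act u (\<Sum>\<psi>\<in>E_basis. a \<psi> * \<psi> (act (antipode v) b)))"
      by (simp add: act_mult_End_H E_basis_End_H tsum_sum[symmetric] act_sum)
    then show ?thesis by (simp add: assms(1))
  qed
  have "(\<Sum>\<psi>\<in>E_basis. sA (coord e (a \<psi>)) (\<psi> b)) = 0" for b
  proof -
    have "(\<Sum>\<psi>\<in>E_basis. sA (coord e (a \<psi>)) (\<psi> b))
      = (\<Sum>\<psi>\<in>E_basis. tsum (coord_tensor e) (\<lambda>y g. y * act g (a \<psi>)) * \<psi> b)"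
      by (simp add: coord_tensor A.scale_mult_left)
    also have "\<dots> = tsum (coord_tensor e) (\<lambda>y g. y * (\<Sum>\<psi>\<in>E_basis. act g (a \<psi>) * \<psi> b))"
      by (simp add: sum_distrib_left tsum_mult_right tsum_sum mult.assoc)
    finally show ?thesis by (simp add: act_zero_sum)
  qed
  then have "(\<Sum>\<psi>\<in>E_basis. fun_scale sA (coord e (a \<psi>)) \<psi>) = 0"
    by (simp add: fun_eq_iff sum_fun_apply fun_scale_def)
  then show "coord e (a \<psi>) = 0"
    by (rule F.independentD[OF E_basis(1,3) subset_refl _ assms(2)])
qed

section \<open>The algebra dual to the equivariant endomorphisms\<close>

lemma End_H_zero: "\<phi> \<in> End_H sA act \<Longrightarrow> \<phi> 0 = 0"
  using additive_zero[of \<phi>] by (simp add: End_H_iff)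

lemma End_H_sum:
  assumes "\<phi> \<in> End_H sA act"
  shows "\<phi> (sum f I) = (\<Sum>i\<in>I. \<phi> (f i))"
  by (induction I rule: infinite_finite_induct)
     (use assms End_H_zero[OF assms] in \<open>auto simp: End_H_iff\<close>)

lemma End_H_tsum: "\<phi> \<in> End_H sA act \<Longrightarrow> \<phi> (tsum xs B) = tsum xs (\<lambda>u v. \<phi> (B u v))"
  by (rule tsum_hom) (simp add: End_H_iff)

text \<open>
  Expand \<open>b \<mapsto> \<phi>(a b)\<close> in the basis: \<open>\<phi>(a b) = \<Sum> c\<^sub>\<psi>(a) \<psi>(b)\<close>. The coefficients depend linearly on \<open>a\<close>;
  they are \<open>H\<close>-linear in \<open>a\<close> because \<open>k c\<^sub>\<psi>(a)\<close> and \<open>c\<^sub>\<psi>(k a)\<close> are coefficients of the same map.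
\<close>

lemma E_comult_exists:
  assumes "\<phi> \<in> End_H sA act"
  shows "\<exists>xs. set xs \<subseteq> End_H sA act \<times> End_H sA act \<and> (\<forall>a b. \<phi> (a * b) = tsum xs (\<lambda>\<phi>' \<phi>''. \<phi>' a * \<phi>'' b))"
proof -
  define c where "c \<psi> a = E_coeff \<psi> (\<lambda>b. \<phi> (a * b))" for \<psi> a
  note \<phi> = assms[unfolded End_H_iff]
  have c: "(\<Sum>\<psi>\<in>E_basis. c \<psi> a * \<psi> b) = \<phi> (a * b)" for a b
    unfolding c_def using \<phi>
    by (intro sum_E_coeff) (simp add: Vector_Spaces.linear_iff A.vector_space_axioms scale_simps)
  have cE: "c \<psi> \<in> End_H sA act" if "\<psi> \<in> E_basis" for \<psi>
  proof -
    have "c \<psi> (act k a) = act k (c \<psi> a)" for k a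
    proof -
      have "(\<Sum>\<psi>\<in>E_basis. act k (c \<psi> a) * \<psi> b) = \<phi> (act k a * b)" for b
      proof -
        have "(\<Sum>\<psi>\<in>E_basis. act k (c \<psi> a) * \<psi> b)
          = tsum (comult k) (\<lambda>u v. act u (\<Sum>\<psi>\<in>E_basis. c \<psi> a * \<psi> (act (antipode v) b)))"
          by (simp add: act_mult_End_H E_basis_End_H tsum_sum[symmetric] act_sum)
        also have "\<dots> = \<phi> (tsum (comult k) (\<lambda>u v. act u (a * act (antipode v) b)))"
          using \<phi> by (simp add: c End_H_tsum[OF assms])
        also have "\<dots> = \<phi> (act k a * b)" by (simp add: act_mult_End_H[OF id_End_H])
        finally show ?thesis .
      qed
      then have "(\<Sum>\<psi>\<in>E_basis. (c \<psi> (act k a) - act k (c \<psi> a)) * \<psi> b) = 0" for b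
        by (simp add: left_diff_distrib sum_subtractf c)
      from E_basis_free[OF this that] show ?thesis by simp
    qed
    then show ?thesis using \<phi>
      by (simp add: End_H_iff c_def E_coeff_def scale_simps sum.distrib A.scale_sum_right)
  qed
  obtain L where L: "set L = E_basis" "distinct L" using finite_distinct_list[OF E_basis(3)] by blast
  have "tsum (map (\<lambda>\<psi>. (c \<psi>, \<psi>)) L) (\<lambda>\<phi>' \<phi>''. \<phi>' a * \<phi>'' b) = \<phi> (a * b)" for a b
    unfolding c[symmetric] L(1)[symmetric] sum_list_distinct_conv_sum_set[OF L(2), symmetric]
    by (simp add: tsum_def comp_def)
  then show ?thesis using cE E_basis_End_H L
    by (intro exI[of _ "map (\<lambda>\<psi>. (c \<psi>, \<psi>)) L"]) auto
qed

lemma E_comult: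
  assumes "\<phi> \<in> End_H sA act"
  shows "set (E_comult sA act \<phi>) \<subseteq> End_H sA act \<times> End_H sA act"
    and "\<phi> (a * b) = tsum (E_comult sA act \<phi>) (\<lambda>\<phi>' \<phi>''. \<phi>' a * \<phi>'' b)"
  using someI_ex[OF E_comult_exists[OF assms, unfolded tsum_def]]
  unfolding E_comult_def tsum_def by blast+

lemma E_dual_mult_eq:
  "\<phi> \<in> End_H sA act \<Longrightarrow> E_dual_mult sA act f g \<phi> = tsum (E_comult sA act \<phi>) (\<lambda>\<phi>' \<phi>''. f \<phi>' * g \<phi>'')"
  by (simp add: E_dual_mult_def tsum_def)

lemma E_dual_iff:
  "f \<in> E_dual sA act \<longleftrightarrow> (\<forall>x\<in>End_H sA act. \<forall>y\<in>End_H sA act. f (x + y) = f x + f y) \<and>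
    (\<forall>c. \<forall>x\<in>End_H sA act. f (fun_scale sA c x) = c * f x) \<and> (\<forall>x. x \<notin> End_H sA act \<longrightarrow> f x = 0)"
  by (simp add: E_dual_def dual_space_def lin_maps_def)

lemma E_dual_expand:
  assumes "f \<in> E_dual sA act" "\<phi> \<in> End_H sA act"
  shows "f \<phi> = (\<Sum>\<chi>\<in>E_basis. F.representation E_basis \<phi> \<chi> * f \<chi>)"
proof -
  have "f \<phi> = f (\<Sum>\<chi>\<in>E_basis. fun_scale sA (F.representation E_basis \<phi> \<chi>) \<chi>)"
    using F.sum_representation_eq[of E_basis \<phi> E_basis] E_basis assms by simp
  also have "\<dots> = (\<Sum>\<chi>\<in>E_basis. F.representation E_basis \<phi> \<chi> * f \<chi>)"
    using assms(1) unfolding E_dual_def dual_space_def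
    by (intro lin_maps_sum[OF F.vector_space_axioms vector_space_times subspace_End_H])
       (auto simp: E_basis_End_H)
  finally show ?thesis .
qed

text \<open>
  Freeness is applied to the second factor first, and to the scalar coefficients of the first factor
  afterwards. So \<open>E \<otimes> E \<rightarrow> Hom(A \<otimes> A, A)\<close> is injective, which is the uniqueness of \<open>\<Delta>\<close> on \<open>E\<close>.
\<close>

lemma E_tensor_vanish:
  assumes xs: "set xs \<subseteq> End_H sA act \<times> End_H sA act"
    and eq: "\<And>a b. tsum xs (\<lambda>\<phi> \<psi>. \<phi> a * \<psi> b) = 0"
    and f: "f \<in> E_dual sA act" and g: "g \<in> E_dual sA act"
  shows "tsum xs (\<lambda>\<phi> \<psi>. f \<phi> * g \<psi>) = 0"
proof -
  let ?r = "F.representation E_basis"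
  have 1: "tsum xs (\<lambda>\<phi> \<psi>. sA (?r \<psi> \<chi>) (\<phi> a)) = 0" if "\<chi> \<in> E_basis" for \<chi> a
  proof (rule E_basis_free[OF _ that])
    fix b
    have "(\<Sum>\<chi>\<in>E_basis. tsum xs (\<lambda>\<phi> \<psi>. sA (?r \<psi> \<chi>) (\<phi> a)) * \<chi> b)
      = tsum xs (\<lambda>\<phi> \<psi>. \<phi> a * (\<Sum>\<chi>\<in>E_basis. sA (?r \<psi> \<chi>) (\<chi> b)))"
      by (simp add: sum_distrib_left tsum_mult_right tsum_sum A.scale_mult_left A.scale_mult_right)
    also have "\<dots> = tsum xs (\<lambda>\<phi> \<psi>. \<phi> a * \<psi> b)"
      using xs by (intro tsum_cong) (auto simp: End_H_expand)
    finally show "(\<Sum>\<chi>\<in>E_basis. tsum xs (\<lambda>\<phi> \<psi>. sA (?r \<psi> \<chi>) (\<phi> a)) * \<chi> b) = 0"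
      by (simp add: eq)
  qed
  have 2: "tsum xs (\<lambda>\<phi> \<psi>. ?r \<psi> \<chi> * ?r \<phi> \<chi>') = 0" if "\<chi> \<in> E_basis" "\<chi>' \<in> E_basis" for \<chi> \<chi>'
  proof -
    have "sA (tsum xs (\<lambda>\<phi> \<psi>. ?r \<psi> \<chi> * ?r \<phi> \<chi>')) 1 = 0"
    proof (rule E_basis_free[OF _ that(2)])
      fix a
      have "(\<Sum>\<chi>'\<in>E_basis. sA (tsum xs (\<lambda>\<phi> \<psi>. ?r \<psi> \<chi> * ?r \<phi> \<chi>')) 1 * \<chi>' a)
        = tsum xs (\<lambda>\<phi> \<psi>. sA (?r \<psi> \<chi>) (\<Sum>\<chi>'\<in>E_basis. sA (?r \<phi> \<chi>') (\<chi>' a)))"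
        by (simp add: A.scale_mult_left A.scale_sum_right tsum_sum tsum_mult_right
          tsum_hom[of "\<lambda>c. sA c _"] A.scale_left_distrib)
      also have "\<dots> = tsum xs (\<lambda>\<phi> \<psi>. sA (?r \<psi> \<chi>) (\<phi> a))"
        using xs by (intro tsum_cong) (auto simp: End_H_expand)
      finally show "(\<Sum>\<chi>'\<in>E_basis. sA (tsum xs (\<lambda>\<phi> \<psi>. ?r \<psi> \<chi> * ?r \<phi> \<chi>')) 1 * \<chi>' a) = 0"
        by (simp add: 1[OF that(1)])
    qed
    then show ?thesis by simp
  qed
  have "tsum xs (\<lambda>\<phi> \<psi>. f \<phi> * g \<psi>)
    = tsum xs (\<lambda>\<phi> \<psi>. \<Sum>\<chi>\<in>E_basis. \<Sum>\<chi>'\<in>E_basis. (g \<chi> * f \<chi>') * (?r \<psi> \<chi> * ?r \<phi> \<chi>'))"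
  proof (rule tsum_cong)
    fix \<phi> \<psi> assume "(\<phi>, \<psi>) \<in> set xs"
    then have "\<phi> \<in> End_H sA act" "\<psi> \<in> End_H sA act" using xs by auto
    then have "g \<psi> * f \<phi> = (\<Sum>\<chi>\<in>E_basis. ?r \<psi> \<chi> * g \<chi>) * (\<Sum>\<chi>'\<in>E_basis. ?r \<phi> \<chi>' * f \<chi>')"
      using E_dual_expand f g by simp
    also have "\<dots> = (\<Sum>\<chi>\<in>E_basis. \<Sum>\<chi>'\<in>E_basis. (g \<chi> * f \<chi>') * (?r \<psi> \<chi> * ?r \<phi> \<chi>'))"
      unfolding sum_product by (simp only: mult_ac)
    finally show "f \<phi> * g \<psi> = (\<Sum>\<chi>\<in>E_basis. \<Sum>\<chi>'\<in>E_basis. (g \<chi> * f \<chi>') * (?r \<psi> \<chi> * ?r \<phi> \<chi>'))"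
      by (simp only: mult.commute)
  qed
  also have "\<dots> = 0" by (simp add: tsum_sum tsum_mult_left[symmetric] 2)
  finally show ?thesis .
qed

text \<open>
  Products in \<open>E\<^sup>*\<close> may be computed with any representation of \<open>\<Delta> \<phi>\<close>. The difference of two
  representations is the list in which the first components of one of them are negated.
\<close>

lemma E_dual_mult_eqI:
  assumes \<phi>: "\<phi> \<in> End_H sA act" and f: "f \<in> E_dual sA act" and g: "g \<in> E_dual sA act"
    and xs: "set xs \<subseteq> End_H sA act \<times> End_H sA act"
    and eq: "\<And>a b. \<phi> (a * b) = tsum xs (\<lambda>\<phi>' \<phi>''. \<phi>' a * \<phi>'' b)"
  shows "E_dual_mult sA act f g \<phi> = tsum xs (\<lambda>\<phi>' \<phi>''. f \<phi>' * g \<phi>'')"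
proof -
  have neg: "f (- \<psi>) = - f \<psi>" "- \<psi> \<in> End_H sA act" if "\<psi> \<in> End_H sA act" for \<psi>
  proof -
    have "f (fun_scale sA (- 1) \<psi>) = - 1 * f \<psi>" using f that unfolding E_dual_iff by blast
    then show "f (- \<psi>) = - f \<psi>" by simp
    show "- \<psi> \<in> End_H sA act" using F.subspace_neg[OF subspace_End_H that] .
  qed
  let ?ys = "map (\<lambda>(\<phi>', \<phi>''). (- \<phi>', \<phi>'')) xs"
  have minus: "tsum xs (\<lambda>u v. - B u v) = - tsum xs B" for B :: "_ \<Rightarrow> _ \<Rightarrow> 'x::ab_group_add"
    by (rule tsum_hom[symmetric]) simp
  have "tsum (E_comult sA act \<phi> @ ?ys) (\<lambda>\<phi>' \<phi>''. f \<phi>' * g \<phi>'') = 0"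
    by (rule E_tensor_vanish[OF _ _ f g]) (use E_comult[OF \<phi>] xs neg eq in \<open>auto simp: minus\<close>)
  moreover have "tsum xs (\<lambda>\<phi>' \<phi>''. f (- \<phi>') * g \<phi>'') = tsum xs (\<lambda>\<phi>' \<phi>''. - (f \<phi>' * g \<phi>''))"
    by (intro tsum_cong) (use xs neg in auto)
  ultimately show ?thesis by (simp add: E_dual_mult_eq[OF \<phi>] minus)
qed

lemma E_dual_mult_closed:
  assumes f: "f \<in> E_dual sA act" and g: "g \<in> E_dual sA act"
  shows "E_dual_mult sA act f g \<in> E_dual sA act"
  unfolding E_dual_iff
proof (intro conjI ballI allI impI)
  fix x y assume x: "x \<in> End_H sA act" and y: "y \<in> End_H sA act"
  show "E_dual_mult sA act f g (x + y) = E_dual_mult sA act f g x + E_dual_mult sA act f g y"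
    using E_dual_mult_eqI[OF F.subspace_add[OF subspace_End_H x y] f g,
        of "E_comult sA act x @ E_comult sA act y"] E_comult[OF x] E_comult[OF y]
    by (simp add: E_dual_mult_eq x y)
next
  fix c x assume x: "x \<in> End_H sA act"
  let ?ys = "map (\<lambda>(\<phi>', \<phi>''). (fun_scale sA c \<phi>', \<phi>'')) (E_comult sA act x)"
  have "E_dual_mult sA act f g (fun_scale sA c x) = tsum ?ys (\<lambda>\<phi>' \<phi>''. f \<phi>' * g \<phi>'')"
    using E_comult[OF x] F.subspace_scale[OF subspace_End_H]
    by (intro E_dual_mult_eqI[OF F.subspace_scale[OF subspace_End_H x] f g])
       (auto simp: fun_scale_def sA_tsum A.scale_mult_left)
  also have "\<dots> = tsum (E_comult sA act x) (\<lambda>\<phi>' \<phi>''. c * (f \<phi>' * g \<phi>''))"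
    unfolding tsum_map using E_comult(1)[OF x] f by (intro tsum_cong) (auto simp: E_dual_iff)
  finally show "E_dual_mult sA act f g (fun_scale sA c x) = c * E_dual_mult sA act f g x"
    by (simp add: E_dual_mult_eq x tsum_mult_left)
qed (simp add: E_dual_mult_def)

lemma E_counit_scale: "\<phi> \<in> End_H sA act \<Longrightarrow> sA (E_counit sA act \<phi>) 1 = \<phi> 1"
proof -
  assume \<phi>: "\<phi> \<in> End_H sA act"
  have "act h (\<phi> 1) = sA (counit h) (\<phi> 1)" for h
  proof -
    have "act h (\<phi> 1) = \<phi> (act h 1)" using \<phi> by (simp add: End_H_iff del: act_simps)
    then show ?thesis using \<phi> by (simp add: End_H_iff)
  qed
  then obtain c where "\<phi> 1 = sA c 1" using invariant_imp_scalar by blast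
  then show ?thesis using \<phi> by (simp add: E_counit_def)
qed

text \<open>
  For functionals that are given only through scalar multiples of \<open>1 \<in> A\<close>, as \<open>\<epsilon>\<close> and \<open>\<Upsilon>\<^sub>\<tau>\<^sub>\<sigma>\<close> are.
\<close>

lemma E_dualI:
  assumes "\<And>\<phi>. \<phi> \<notin> End_H sA act \<Longrightarrow> f \<phi> = 0"
    and "\<And>\<phi>. \<phi> \<in> End_H sA act \<Longrightarrow> sA (f \<phi>) 1 = G \<phi>"
    and "\<And>x y. x \<in> End_H sA act \<Longrightarrow> y \<in> End_H sA act \<Longrightarrow> G (x + y) = G x + G y"
    and "\<And>c x. x \<in> End_H sA act \<Longrightarrow> G (fun_scale sA c x) = sA c (G x)"
  shows "f \<in> E_dual sA act"
  unfolding E_dual_iff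
proof (intro conjI ballI allI impI)
  fix x y assume x: "x \<in> End_H sA act" and y: "y \<in> End_H sA act"
  have "sA (f (x + y)) 1 = sA (f x + f y) 1"
    using assms x y by (simp add: F.subspace_add subspace_End_H A.scale_left_distrib)
  then show "f (x + y) = f x + f y" by simp
next
  fix c x assume x: "x \<in> End_H sA act"
  have "sA (f (fun_scale sA c x)) 1 = sA (c * f x) 1"
    using assms(2)[OF F.subspace_scale[OF subspace_End_H x]] assms(4)[OF x] assms(2)[OF x]
    by (metis A.scale_scale)
  then show "f (fun_scale sA c x) = c * f x" by simp
qed (rule assms(1))

lemma E_counit_E_dual: "E_counit sA act \<in> E_dual sA act"
proof (rule E_dualI[where G="\<lambda>\<phi>. \<phi> 1"])
  show "E_counit sA act \<phi> = 0" if "\<phi> \<notin> End_H sA act" for \<phi>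
    using that by (simp add: E_counit_def)
qed (simp_all add: E_counit_scale fun_scale_def)

lemma subspace_E_dual: "module.subspace (fun_scale (*)) (E_dual sA act)"
  unfolding E_dual_def by (rule subspace_dual_space)

lemma subalgebra_E_dual:
  "subalgebra (fun_scale (*)) (E_dual_mult sA act) (E_counit sA act) (E_dual sA act) (E_dual sA act)"
  by (simp add: subalgebra_def subspace_E_dual E_counit_E_dual E_dual_mult_closed)

text \<open>
  Functionals in \<open>E\<^sup>*\<close> are determined by their values on a finite basis of \<open>E\<close>, and any linear
  combination of these values is the value at one element of \<open>E\<close>.
\<close>

lemma E_dual_double_annihilator:
  assumes B: "B \<subseteq> E_dual sA act" "module.subspace (fun_scale (*)) B" and l: "l \<in> E_dual sA act"
    and ann: "\<And>\<phi>. \<phi> \<in> End_H sA act \<Longrightarrow> (\<And>f. f \<in> B \<Longrightarrow> f \<phi> = 0) \<Longrightarrow> l \<phi> = 0"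
  shows "l \<in> B"
proof -
  have "\<exists>g\<in>B. \<forall>\<chi>\<in>E_basis. g \<chi> = l \<chi>"
  proof (rule double_annihilator[OF E_basis(3) B(2)])
    fix c assume c: "\<And>g. g \<in> B \<Longrightarrow> (\<Sum>\<chi>\<in>E_basis. c \<chi> * g \<chi>) = 0"
    let ?\<phi> = "\<Sum>\<chi>\<in>E_basis. fun_scale sA (c \<chi>) \<chi>"
    have \<phi>: "?\<phi> \<in> End_H sA act"
      by (intro F.subspace_sum F.subspace_scale subspace_End_H E_basis_End_H)
    have ev: "g ?\<phi> = (\<Sum>\<chi>\<in>E_basis. c \<chi> * g \<chi>)" if "g \<in> E_dual sA act" for g
      using that unfolding E_dual_def dual_space_def
      by (intro lin_maps_sum[OF F.vector_space_axioms vector_space_times subspace_End_H])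
         (auto simp: E_basis_End_H)
    show "(\<Sum>\<chi>\<in>E_basis. c \<chi> * l \<chi>) = 0"
      unfolding ev[OF l, symmetric]
    proof (rule ann[OF \<phi>])
      fix g assume "g \<in> B"
      with B(1) have "g \<in> E_dual sA act" by blast
      from ev[OF this] c[OF \<open>g \<in> B\<close>] show "g ?\<phi> = 0" by (rule HOL.trans)
    qed
  qed
  then obtain g where g: "g \<in> B" "\<And>\<chi>. \<chi> \<in> E_basis \<Longrightarrow> g \<chi> = l \<chi>" by blast
  have "g \<phi> = l \<phi>" for \<phi>
  proof (cases "\<phi> \<in> End_H sA act")
    case True
    have "g \<in> E_dual sA act" using g(1) B(1) by blast
    from E_dual_expand[OF this True] E_dual_expand[OF l True] show ?thesis using g(2) by simp
  next
    case False
    then show ?thesis using g(1) l B(1) by (auto simp: E_dual_iff)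
  qed
  then have "g = l" by (rule ext)
  then show ?thesis using g(1) by simp
qed

section \<open>Nondegeneracy of the pairing with the right dual\<close>

lemma D_rdualD:
  assumes "\<tau> \<in> D_rdual antipode sA V act sA act"
  shows "\<tau> \<in> lin_maps (fun_scale (*)) (dual_space sA V) sA"
    and "\<xi> \<in> dual_space sA V \<Longrightarrow> \<tau> (rdual_act antipode V act h \<xi>) = act h (\<tau> \<xi>)"
  using assms by (auto simp: D_rdual_def H_hom_def)

lemma dual_vector:
  assumes "A.subspace V"
  shows "dual_vector sA V e \<in> dual_space sA V"
    and "v \<in> V \<Longrightarrow> (\<Sum>e\<in>some_basis sA V. sA (dual_vector sA V e v) e) = v"
    and "\<xi> \<in> dual_space sA V \<Longrightarrow>
      (\<Sum>e\<in>some_basis sA V. fun_scale (*) (\<xi> e) (dual_vector sA V e)) = \<xi>"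
proof -
  note B = some_basis[OF assms]
  have add: "x + y \<in> V" and scale: "sA c x \<in> V" if "x \<in> V" "y \<in> V" for x y c
    using assms that A.subspace_add A.subspace_scale by auto
  show dv: "dual_vector sA V e \<in> dual_space sA V" for e
    unfolding dual_space_def lin_maps_def dual_vector_def
    using B add scale by (auto simp: A.representation_add A.representation_scale)
  show exp: "(\<Sum>e\<in>some_basis sA V. sA (dual_vector sA V e v) e) = v" if "v \<in> V" for v
    using A.sum_representation_eq[of "some_basis sA V" v "some_basis sA V"] B that
    by (simp add: dual_vector_def)
  assume \<xi>: "\<xi> \<in> dual_space sA V"
  show "(\<Sum>e\<in>some_basis sA V. fun_scale (*) (\<xi> e) (dual_vector sA V e)) = \<xi>"
  proof
    fix v
    show "(\<Sum>e\<in>some_basis sA V. fun_scale (*) (\<xi> e) (dual_vector sA V e)) v = \<xi> v"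
    proof (cases "v \<in> V")
      case True
      have "\<xi> v = \<xi> (\<Sum>e\<in>some_basis sA V. sA (dual_vector sA V e v) e)" by (simp add: exp True)
      also have "\<dots> = (\<Sum>e\<in>some_basis sA V. dual_vector sA V e v * \<xi> e)"
        using \<xi> B(2) A.span_base unfolding dual_space_def
        by (intro lin_maps_sum[OF A.vector_space_axioms vector_space_times assms]) auto
      finally show ?thesis by (simp add: sum_fun_apply fun_scale_def mult.commute)
    next
      case False
      then show ?thesis using \<xi>
        by (simp add: sum_fun_apply fun_scale_def dual_vector_def dual_space_def lin_maps_def)
    qed
  qed
qed

text \<open>
  \<open>\<Sum>\<^sub>e \<tau>(e\<^sup>*) \<otimes> k e = \<Sum>\<^sub>e S(k) \<tau>(e\<^sup>*) \<otimes> e\<close>: moving \<open>k\<close> from \<open>e\<close> to \<open>e\<^sup>*\<close> gives \<open>e\<^sup>*(k \<cdot>)\<close>, which is \<open>S(k) e\<^sup>*\<close>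
  for the action on the right dual. The additional \<open>u\<close> is needed for \<open>k\<close> running
  through the second factors of \<open>\<Delta> h\<close>.
\<close>

lemma D_rdual_swap:
  assumes V: "A.subspace V" "\<And>h v. v \<in> V \<Longrightarrow> act h v \<in> V"
    and \<tau>: "\<tau> \<in> D_rdual antipode sA V act sA act" and \<phi>: "\<phi> \<in> End_H sA act"
  shows "(\<Sum>e\<in>some_basis sA V. act u (\<tau> (dual_vector sA V e)) * \<phi> (act k e))
    = (\<Sum>e\<in>some_basis sA V. act (u * antipode k) (\<tau> (dual_vector sA V e)) * \<phi> e)"
proof -
  let ?B = "some_basis sA V" and ?dv = "dual_vector sA V"
  have BV: "e \<in> V" if "e \<in> ?B" for e using that some_basis(2)[OF V(1)] A.span_base by blast
  have 1: "act (antipode k) (\<tau> (?dv e)) = (\<Sum>d\<in>?B. sA (?dv e (act k d)) (\<tau> (?dv d)))" for e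
  proof -
    let ?\<xi> = "rdual_act antipode V act (antipode k) (?dv e)"
    have dv: "?dv e \<in> dual_space sA V" by (rule dual_vector(1)[OF V(1)])
    have \<xi>: "?\<xi> \<in> dual_space sA V"
      using dv V A.subspace_add[OF V(1)] A.subspace_scale[OF V(1)]
      by (auto simp: dual_space_def lin_maps_def rdual_act_def)
    have "act (antipode k) (\<tau> (?dv e)) = \<tau> ?\<xi>"
      using D_rdualD(2)[OF \<tau> dv] by simp
    also have "\<tau> ?\<xi> = \<tau> (\<Sum>d\<in>?B. fun_scale (*) (?\<xi> d) (?dv d))"
      by (simp add: dual_vector(3)[OF V(1) \<xi>])
    also have "\<dots> = (\<Sum>d\<in>?B. sA (?\<xi> d) (\<tau> (?dv d)))"
      by (intro lin_maps_sum[OF vector_space_fun_scale[OF vector_space_times] A.vector_space_axioms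
            subspace_dual_space D_rdualD(1)[OF \<tau>]]
          dual_vector(1)[OF V(1)])
    also have "\<dots> = (\<Sum>d\<in>?B. sA (?dv e (act k d)) (\<tau> (?dv d)))"
      by (intro sum.cong HOL.refl) (simp add: rdual_act_def BV)
    finally show ?thesis .
  qed
  have "(\<Sum>e\<in>?B. act (u * antipode k) (\<tau> (?dv e)) * \<phi> e)
      = (\<Sum>e\<in>?B. \<Sum>d\<in>?B. act u (\<tau> (?dv d)) * \<phi> (sA (?dv e (act k d)) e))"
    using \<phi> by (simp add: act_act 1 act_sum sum_distrib_right A.scale_mult_left A.scale_mult_right End_H_iff)
  also have "\<dots> = (\<Sum>d\<in>?B. act u (\<tau> (?dv d)) * \<phi> (\<Sum>e\<in>?B. sA (?dv e (act k d)) e))"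
    by (subst sum.swap) (simp add: End_H_sum[OF \<phi>] sum_distrib_left)
  also have "\<dots> = (\<Sum>d\<in>?B. act u (\<tau> (?dv d)) * \<phi> (act k d))"
    by (intro sum.cong HOL.refl) (simp add: dual_vector(2)[OF V(1)] V(2) BV)
  finally show ?thesis ..
qed

text \<open>
  The sum is invariant under \<open>h\<close>: moving \<open>h''\<close> to the other side replaces \<open>h' \<otimes> h''\<close> by \<open>h' S(h'')\<close>. So
  it lies in \<open>A\<^sup>H = k\<close>.
\<close>

lemma Upsilon_scale:
  assumes V: "A.subspace V" "\<And>h v. v \<in> V \<Longrightarrow> act h v \<in> V"
    and \<tau>: "\<tau> \<in> D_rdual antipode sA V act sA act" and \<phi>: "\<phi> \<in> End_H sA act"
  shows "sA (Upsilon sA V sA act \<tau> (inclusion V) \<phi>) 1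
    = (\<Sum>e\<in>some_basis sA V. \<tau> (dual_vector sA V e) * \<phi> e)"
proof -
  let ?B = "some_basis sA V" and ?dv = "dual_vector sA V"
  let ?s = "\<Sum>e\<in>?B. \<tau> (?dv e) * \<phi> e"
  have "act h ?s = sA (counit h) ?s" for h
  proof -
    have "act h ?s = tsum (comult h) (\<lambda>u v. \<Sum>e\<in>?B. act u (\<tau> (?dv e)) * \<phi> (act v e))"
      using \<phi> by (simp add: act_sum act_mult_tsum tsum_sum End_H_iff)
    also have "\<dots> = tsum (comult h) (\<lambda>u v. \<Sum>e\<in>?B. act (u * antipode v) (\<tau> (?dv e)) * \<phi> e)"
      by (simp only: D_rdual_swap[OF V \<tau> \<phi>])
    also have "\<dots> = (\<Sum>e\<in>?B. act (sH (counit h) 1) (\<tau> (?dv e)) * \<phi> e)"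
      by (rule H.tsum_antipode_right) (simp add: algebra_simps sum.distrib)
    finally show ?thesis by (simp add: A.scale_mult_left A.scale_sum_right)
  qed
  then obtain c where c: "?s = sA c 1" using invariant_imp_scalar by blast
  have "(\<Sum>e\<in>?B. \<tau> (?dv e) * \<phi> (inclusion V e)) = ?s"
    using some_basis(2)[OF V(1)] A.span_base by (intro sum.cong HOL.refl) (auto simp: inclusion_def)
  then show ?thesis using \<phi> c by (simp add: Upsilon_def)
qed

lemma Upsilon_E_dual:
  assumes V: "A.subspace V" "\<And>h v. v \<in> V \<Longrightarrow> act h v \<in> V"
    and \<tau>: "\<tau> \<in> D_rdual antipode sA V act sA act"
  shows "Upsilon sA V sA act \<tau> (inclusion V) \<in> E_dual sA act"
proof (rule E_dualI[OF _ Upsilon_scale[OF V \<tau>]])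
  show "Upsilon sA V sA act \<tau> (inclusion V) \<phi> = 0" if "\<phi> \<notin> End_H sA act" for \<phi>
    using that by (simp add: Upsilon_def)
qed (simp_all add: fun_scale_def algebra_simps sum.distrib A.scale_sum_right A.scale_mult_right)

text \<open>
  These elements of \<open>D(\<^sup>*V)\<close> suffice to test whether an element of \<open>E\<close> vanishes at \<open>v\<close>. The value outside
  the dual space follows the convention for maps on subspaces.
\<close>

definition rdual_hom :: "'a set \<Rightarrow> 'a \<Rightarrow> 'a \<Rightarrow> ('a \<Rightarrow> 'k) \<Rightarrow> 'a" where
  "rdual_hom V e v \<xi> =
    (if \<xi> \<in> dual_space sA V then tsum (coord_tensor e) (\<lambda>y g. sA (\<xi> (act g v)) y) else 0)"

lemma balanced_rdual_hom:
  assumes V: "\<And>h v. v \<in> V \<Longrightarrow> act h v \<in> V" and v: "v \<in> V" and \<xi>: "\<xi> \<in> dual_space sA V"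
  shows "balanced sA sH (\<lambda>y g. sA (\<xi> (act g v)) y)"
  using \<xi> V[OF v]
  by (simp add: balanced_def scale_simps dual_space_def lin_maps_def)

lemma rdual_hom_D_rdual:
  assumes V: "A.subspace V" "\<And>h v. v \<in> V \<Longrightarrow> act h v \<in> V" and v: "v \<in> V"
  shows "rdual_hom V e v \<in> D_rdual antipode sA V act sA act"
proof -
  note sub = subspace_dual_space[of sA V, unfolded fun_subspace_iff[OF vector_space_times]]
  have "rdual_hom V e v (rdual_act antipode V act h \<xi>) = act h (rdual_hom V e v \<xi>)"
    if \<xi>: "\<xi> \<in> dual_space sA V" for h \<xi>
  proof -
    \<comment> \<open>\<open>h\<close> acts on \<open>\<xi>\<close> through \<open>S\<^sup>-\<^sup>1(h)\<close>.\<close>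
    define k where "k = inv antipode h"
    have h: "h = antipode k" by (simp add: k_def)
    have "rdual_act antipode V act h \<xi> \<in> dual_space sA V"
      using \<xi> V A.subspace_add[OF V(1)] A.subspace_scale[OF V(1)]
      by (auto simp: dual_space_def lin_maps_def rdual_act_def)
    then have "rdual_hom V e v (rdual_act antipode V act h \<xi>)
        = tsum (coord_tensor e) (\<lambda>y g. sA (\<xi> (act (k * g) v)) y)"
      using V(2)[OF v] by (simp add: rdual_hom_def rdual_act_def h act_act)
    also have "\<dots> = tsum (coord_tensor e) (\<lambda>y g. sA (\<xi> (act g v)) (act h y))"
      unfolding h by (rule coord_tensor_antipode[symmetric, OF balanced_rdual_hom[OF V(2) v \<xi>]])
    also have "\<dots> = act h (rdual_hom V e v \<xi>)"
      using \<xi> by (simp add: rdual_hom_def act_tsum)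
    finally show ?thesis .
  qed
  then show ?thesis
    by (auto simp: D_rdual_def H_hom_def lin_maps_def rdual_hom_def sub fun_scale_def sA_tsum
        A.scale_left_distrib tsum_add plus_fun_def)
qed

lemma sum_rdual_hom:
  assumes V: "\<And>h v. v \<in> V \<Longrightarrow> act h v \<in> V" and v: "v \<in> V" and \<xi>: "\<xi> \<in> dual_space sA V"
  shows "(\<Sum>e\<in>basis. e * rdual_hom V e v \<xi>) = sA (\<xi> v) 1"
  using sum_coord_tensor[OF balanced_rdual_hom[OF V v \<xi>], of 1] \<xi>
  by (simp add: rdual_hom_def tsum_mult_left A.scale_mult_right)

text \<open>
  \<open>\<phi>(v) = \<Sum>\<^sub>d d\<^sup>*(v) \<phi>(d)\<close>, and by \<open>sum_rdual_hom\<close> the scalars \<open>d\<^sup>*(v)\<close> are \<open>A\<close>-linear combinations,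
  with coefficients not depending on \<open>d\<close>, of the values \<open>\<tau>(d\<^sup>*)\<close> for certain \<open>\<tau> \<in> D(\<^sup>*V)\<close>.
\<close>

lemma Upsilon_nondegenerate:
  assumes V: "A.subspace V" "\<And>h v. v \<in> V \<Longrightarrow> act h v \<in> V" and \<phi>: "\<phi> \<in> End_H sA act"
    and zero: "\<And>\<tau>. \<tau> \<in> D_rdual antipode sA V act sA act \<Longrightarrow> Upsilon sA V sA act \<tau> (inclusion V) \<phi> = 0"
    and v: "v \<in> V"
  shows "\<phi> v = 0"
proof -
  let ?B = "some_basis sA V" and ?dv = "dual_vector sA V"
  have "\<phi> v = \<phi> (\<Sum>d\<in>?B. sA (?dv d v) d)" by (simp add: dual_vector(2)[OF V(1) v])
  also have "\<dots> = (\<Sum>d\<in>?B. sA (?dv d v) 1 * \<phi> d)"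
    using \<phi> unfolding End_H_sum[OF \<phi>] by (simp add: End_H_iff A.scale_mult_left)
  also have "\<dots> = (\<Sum>d\<in>?B. (\<Sum>e\<in>basis. e * rdual_hom V e v (?dv d)) * \<phi> d)"
    by (simp add: sum_rdual_hom[OF V(2) v dual_vector(1)[OF V(1)]])
  also have "\<dots> = (\<Sum>e\<in>basis. e * (\<Sum>d\<in>?B. rdual_hom V e v (?dv d) * \<phi> d))"
    unfolding sum_distrib_right sum_distrib_left by (subst sum.swap) (simp add: mult.assoc)
  also have "\<dots> = 0"
    using Upsilon_scale[OF V rdual_hom_D_rdual[OF V v] \<phi>] zero[OF rdual_hom_D_rdual[OF V v]] by simp
  finally show ?thesis .
qed

section \<open>Generation\<close>

text \<open>
  If \<open>N\<close> is the annihilator of \<open>B\<close>, the functionals \<open>\<phi> \<mapsto> e\<^sup>*(\<phi> a)\<close> with \<open>N a = 0\<close> lie in the double annihilator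
  of \<open>B\<close>, hence in \<open>B\<close>. For \<open>N a = N b = 0\<close>, the products of those for \<open>a\<close> and for \<open>b\<close> therefore
  vanish on \<open>N\<close>; their values at \<open>\<phi>\<close> determine \<open>\<phi>(a b) = \<Sum> \<phi>'(a) \<phi>''(b)\<close>.
\<close>

lemma subalgebra_common_kernel:
  assumes B: "subalgebra (fun_scale (*)) (E_dual_mult sA act) (E_counit sA act) (E_dual sA act) B"
  defines "N \<equiv> {\<phi> \<in> End_H sA act. \<forall>f\<in>B. f \<phi> = 0}"
  shows "subalgebra sA (*) 1 UNIV {a. \<forall>\<phi>\<in>N. \<phi> a = 0}"
proof -
  let ?W = "{a. \<forall>\<phi>\<in>N. \<phi> a = 0}"
  have BE: "B \<subseteq> E_dual sA act" and Bs: "module.subspace (fun_scale (*)) B"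
    and B1: "E_counit sA act \<in> B" and Bm: "\<And>f g. f \<in> B \<Longrightarrow> g \<in> B \<Longrightarrow> E_dual_mult sA act f g \<in> B"
    using B by (auto simp: subalgebra_def)
  have NE: "\<phi> \<in> End_H sA act" if "\<phi> \<in> N" for \<phi> using that by (simp add: N_def)
  define m where "m a e \<phi> = (if \<phi> \<in> End_H sA act then coord e (\<phi> a) else 0)" for a e \<phi>
  have mB: "m a e \<in> B" if "a \<in> ?W" for a e
  proof (rule E_dual_double_annihilator[OF BE Bs])
    show "m a e \<in> E_dual sA act"
      using F.subspace_add[OF subspace_End_H] F.subspace_scale[OF subspace_End_H]
      by (auto simp: E_dual_iff m_def fun_scale_def)
    show "m a e \<phi> = 0" if "\<phi> \<in> End_H sA act" "\<And>f. f \<in> B \<Longrightarrow> f \<phi> = 0" for \<phi>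
    proof -
      have "\<phi> \<in> N" using that by (simp add: N_def)
      then have "\<phi> a = 0" using \<open>a \<in> ?W\<close> by simp
      then show ?thesis by (simp add: m_def coord_def A.representation_zero)
    qed
  qed
  have "\<phi> (a * b) = 0" if a: "a \<in> ?W" and b: "b \<in> ?W" and \<phi>: "\<phi> \<in> N" for a b \<phi>
  proof -
    let ?xs = "E_comult sA act \<phi>"
    note C = E_comult[OF NE[OF \<phi>]]
    have 0: "tsum ?xs (\<lambda>\<phi>' \<phi>''. coord e (\<phi>' a) * coord d (\<phi>'' b)) = 0" for e d
    proof -
      have "E_dual_mult sA act (m a e) (m b d) \<phi> = 0"
        using Bm[OF mB[OF a] mB[OF b]] \<phi> by (auto simp: N_def)
      then have "tsum ?xs (\<lambda>\<phi>' \<phi>''. m a e \<phi>' * m b d \<phi>'') = 0"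
        by (simp add: E_dual_mult_eq NE[OF \<phi>])
      moreover have "tsum ?xs (\<lambda>\<phi>' \<phi>''. m a e \<phi>' * m b d \<phi>'')
          = tsum ?xs (\<lambda>\<phi>' \<phi>''. coord e (\<phi>' a) * coord d (\<phi>'' b))"
        using C(1) by (intro tsum_cong) (auto simp: m_def)
      ultimately show ?thesis by simp
    qed
    have "\<phi> (a * b) = tsum ?xs (\<lambda>\<phi>' \<phi>''. (\<Sum>e\<in>basis. sA (coord e (\<phi>' a)) e) * (\<Sum>d\<in>basis. sA (coord d (\<phi>'' b)) d))"
      by (simp add: sum_coord C(2))
    also have "\<dots> = (\<Sum>e\<in>basis. \<Sum>d\<in>basis. sA (tsum ?xs (\<lambda>\<phi>' \<phi>''. coord e (\<phi>' a) * coord d (\<phi>'' b))) (e * d))"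
      unfolding sum_product
      by (simp add: tsum_sum A.scale_mult_left A.scale_mult_right
          tsum_hom[of "\<lambda>c. sA c _"] A.scale_left_distrib mult.commute)
    also have "\<dots> = 0" by (simp add: 0)
    finally show ?thesis .
  qed
  moreover have "1 \<in> ?W"
  proof clarify
    fix \<phi> assume "\<phi> \<in> N"
    then have "E_counit sA act \<phi> = 0" using B1 by (simp add: N_def)
    then show "\<phi> 1 = 0" using E_counit_scale[OF NE[OF \<open>\<phi> \<in> N\<close>]] by simp
  qed
  moreover have "A.subspace ?W"
  proof (rule A.subspaceI)
    show "0 \<in> ?W" using NE End_H_zero by blast
  next
    fix x y assume xy: "x \<in> ?W" "y \<in> ?W"
    have "\<phi> (x + y) = 0" if "\<phi> \<in> N" for \<phi>
    proof -
      have "\<phi> x = 0" "\<phi> y = 0" using xy that by blast+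
      then show ?thesis using NE[OF that] by (simp add: End_H_iff)
    qed
    then show "x + y \<in> ?W" by blast
  next
    fix c x assume x: "x \<in> ?W"
    have "\<phi> (sA c x) = 0" if "\<phi> \<in> N" for \<phi>
    proof -
      have "\<phi> x = 0" using x that by blast
      then show ?thesis using NE[OF that] by (simp add: End_H_iff)
    qed
    then show "sA c x \<in> ?W" by blast
  qed
  ultimately show ?thesis by (auto simp: subalgebra_def)
qed

lemma generates_Upsilon:
  assumes V: "A.subspace V" "\<And>h v. v \<in> V \<Longrightarrow> act h v \<in> V"
    and gen: "generates sA (*) 1 UNIV V"
  shows "generates (fun_scale (*)) (E_dual_mult sA act) (E_counit sA act) (E_dual sA act)
    {Upsilon sA V sA act \<tau> (inclusion V) | \<tau>. \<tau> \<in> D_rdual antipode sA V act sA act}"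
    (is "generates _ _ _ _ ?X")
  unfolding generates_def
proof (intro conjI subset_antisym)
  show X: "?X \<subseteq> E_dual sA act" using Upsilon_E_dual[OF V] by blast
  let ?P = "subalgebra (fun_scale (*)) (E_dual_mult sA act) (E_counit sA act) (E_dual sA act)"
  show "?P hull ?X \<subseteq> E_dual sA act"
    by (rule hull_minimal[where S="?P", OF X subalgebra_E_dual])
  have "E_dual sA act \<subseteq> B" if XB: "?X \<subseteq> B" and B: "?P B" for B
  proof
    fix l assume l: "l \<in> E_dual sA act"
    have BE: "B \<subseteq> E_dual sA act" "module.subspace (fun_scale (*)) B"
      using B by (auto simp: subalgebra_def)
    show "l \<in> B"
    proof (rule E_dual_double_annihilator[OF BE l])
      fix \<phi> assume \<phi>: "\<phi> \<in> End_H sA act" and ann: "\<And>f. f \<in> B \<Longrightarrow> f \<phi> = 0"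
      let ?N = "{\<phi> \<in> End_H sA act. \<forall>f\<in>B. f \<phi> = 0}"
      have "V \<subseteq> {a. \<forall>\<phi>\<in>?N. \<phi> a = 0}"
        using XB Upsilon_nondegenerate[OF V] by blast
      then have "subalgebra sA (*) 1 UNIV hull V \<subseteq> {a. \<forall>\<phi>\<in>?N. \<phi> a = 0}"
        by (rule hull_minimal[where S="subalgebra sA (*) 1 UNIV"])
           (rule subalgebra_common_kernel[OF B])
      then have "\<phi> a = 0" for a
        using gen \<phi> ann by (auto simp: generates_def)
      then have "\<phi> = fun_scale sA 0 \<phi>" by (auto simp: fun_scale_def)
      then have "l \<phi> = 0 * l \<phi>" using l \<phi> unfolding E_dual_iff by metis
      then show "l \<phi> = 0" by simp
    qed
  qed
  then show "E_dual sA act \<subseteq> ?P hull ?X" by (auto simp: hull_def)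
qed

end

theorem proposition4p6:
  fixes sH :: "'k::field \<Rightarrow> 'h::ring_1 \<Rightarrow> 'h"
    and comult :: "'h \<Rightarrow> ('h \<times> 'h) list"
    and counit :: "'h \<Rightarrow> 'k"
    and antipode :: "'h \<Rightarrow> 'h"
    and sA :: "'k \<Rightarrow> 'a::ring_1 \<Rightarrow> 'a"
    and act :: "'h \<Rightarrow> 'a \<Rightarrow> 'a"
    and V :: "'a set"
  assumes "finite_dim sH"
    and "module_algebra sH comult counit antipode sA act"
    and "galois sH sA act"
    and "module.subspace sA V"
    and "\<And>h v. v \<in> V \<Longrightarrow> act h v \<in> V"
    and "generates sA (*) 1 UNIV V"
  shows "generates (fun_scale (*)) (E_dual_mult sA act) (E_counit sA act) (E_dual sA act)
    {Upsilon sA V sA act \<tau> (inclusion V) | \<tau>. \<tau> \<in> D_rdual antipode sA V act sA act}"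
proof -
  interpret galois_object sH comult counit antipode sA act
    using assms(1-3) by (intro galois_object.intro galois_object_axioms.intro)
  show ?thesis using assms(4-6) by (rule generates_Upsilon)
qed

end
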